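(* Let $p\in(0,\infty)$ and let $W$ be a matrix weight on $\mathbb R^n$ with values in $M_m(\mathbb C)$. For every cube $Q\subset\mathbb R^n$, let $A_Q$ be a reducing operator of order $p$ for $W$ on $Q$. Then the following conditions are all equivalent (in each of (ii)--(vi) and (viii), the condition is that there exists a positive constant $C$, independent of the cube $Q$ and of $\vec z$, $\vec v$, $U$, $M$, such that the stated inequality holds for every cube $Q\subset\mathbb R^n$): (i) $W\in\widetilde A_{p,\infty}$ (Volberg's condition, defined in the context); (ii) $\exp\left(\fint_Q\log\left|W^{-\frac1p}(x)\vec z\right|\,dx\right)\le C\left|A_Q^{-1}\vec z\right|$ for any $\vec z\in\mathbb C^m$; (iii) $\exp\left(\fint_Q\log_+\left|W^{-\frac1p}(x)A_Q\vec v\right|\,dx\right)\le C$ for any $\vec v\in\mathbb C^m$ with $|\vec v|=1$; (iv) $\exp\left(\fint_Q\log_+\left\|W^{-\frac1p}(x)A_QU\right\|\,dx\right)\le C$ for any $U\in M_m(\mathbb C)$ with $\|U\|=1$; (v) $\exp\left(\fint_Q\log_+\left\|W^{-\frac1p}(x)A_Q\right\|\,dx\right)\le C$; (vi) $\exp\left(\fint_Q\log_+\left(\fint_Q\left\|W^{\frac1p}(x)W^{-\frac1p}(y)\right\|^p\,dx\right)\,dy\right)\le C$; (vii) $W\in A_{p,\infty}$ (defined in the context); (viii) $\exp\left(\fint_Q\log\left\|W^{-\frac1p}(x)M\right\|\,dx\right)\le C\left\|A_Q^{-1}M\right\|$ for any $M\in M_m(\mathbb C)$.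
   Context: Fix $m,n\in\mathbb N$. $M_m(\mathbb C)$ is the set of complex $m\times m$ matrices and $\|\cdot\|$ is the operator norm induced by the Euclidean norm $|\cdot|$ of $\mathbb C^m$. A cube in $\mathbb R^n$ has edges parallel to the coordinate axes and finite positive edge length (not necessarily open or closed). $\fint_E f:=\frac1{|E|}\int_E f$, $\log_+t:=\max\{0,\log t\}$; $\log 0=-\infty$ and $\exp(-\infty)=0$. $(\cdot,\cdot)$ is the inner product of $\mathbb C^m$. A matrix weight is a function $W:\mathbb R^n\to M_m(\mathbb C)$ such that $W(x)$ is nonnegative definite for every $x$, $W(x)$ is invertible for almost every $x$, and all entries of $W$ are locally integrable. Real powers $W^\alpha(x)$ are defined by the spectral theorem. Reducing operator: for a matrix weight $W$ and a bounded measurable set $E$ with $|E|\in(0,\infty)$, a reducing operator of order $p$ for $W$ on $E$ is a positive definite $A_E\in M_m(\mathbb C)$ such that $|A_E\vec z|\sim\left[\fint_E|W^{1/p}(x)\vec z|^p\,dx\right]^{1/p}$ for all $\vec z\in\mathbb C^m$, with positive equivalence constants depending only on $m$ and $p$ (such operators exist). $A_{p,\infty}$: a matrix weight $W$ belongs to $A_{p,\infty}$ if, for every cube $Q$, $\log_+\left(\fint_Q\|W^{1/p}(x)W^{-1/p}(\cdot)\|^p\,dx\right)\in L^1(Q)$, and $[W]_{A_{p,\infty}}:=\sup_Q\exp\left(\fint_Q\log\left(\fint_Q\|W^{1/p}(x)W^{-1/p}(y)\|^p\,dx\right)dy\right)<\infty$, with the supremum over all cubes. $\widetilde A_{p,\infty}$: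 a matrix weight $W$ belongs to $\widetilde A_{p,\infty}$ if there is a constant $C>0$ such that, for every cube $Q$ and every $\vec z\in\mathbb C^m$, $$\exp\left(\fint_Q\log|W^{-1/p}(x)\vec z|\,dx\right)\le C\sup_{\vec u\in\mathbb C^m\setminus\{\vec 0\}}|(\vec z,\vec u)|\left[\fint_Q|W^{1/p}(x)\vec u|^p\,dx\right]^{-1/p}.$$ *)

theory Defs
  imports "HOL-Analysis.Analysis"
begin

section \<open>Complex matrices\<close>

definition cinner_vec :: "complex^'m \<Rightarrow> complex^'m \<Rightarrow> complex" where
  "cinner_vec z u = (\<Sum>i\<in>UNIV. z $ i * cnj (u $ i))"

definition opnorm :: "complex^'m^'m \<Rightarrow> real" where
  "opnorm A = onorm (\<lambda>z. A *v z)"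

definition conj_transpose :: "complex^'m^'m \<Rightarrow> complex^'m^'m" where
  "conj_transpose A = (\<chi> i j. cnj (A $ j $ i))"

definition unitary_matrix :: "complex^'m^'m \<Rightarrow> bool" where
  "unitary_matrix U \<longleftrightarrow> U ** conj_transpose U = mat 1 \<and> conj_transpose U ** U = mat 1"

definition diag_matrix :: "('m \<Rightarrow> real) \<Rightarrow> complex^'m^'m" where
  "diag_matrix d = (\<chi> i j. if i = j then complex_of_real (d i) else 0)"

text \<open>Over the complex numbers a real-valued form \<open>(Az, z)\<close> forces \<open>A\<close> to be Hermitian.\<close>

definition nonneg_definite :: "complex^'m^'m \<Rightarrow> bool" where
  "nonneg_definite A \<longleftrightarrow>
     (\<forall>z. cinner_vec (A *v z) z \<in> \<real> \<and> 0 \<le> Re (cinner_vec (A *v z) z))"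

definition pos_definite :: "complex^'m^'m \<Rightarrow> bool" where
  "pos_definite A \<longleftrightarrow>
     (\<forall>z. z \<noteq> 0 \<longrightarrow> cinner_vec (A *v z) z \<in> \<real> \<and> 0 < Re (cinner_vec (A *v z) z))"

text \<open>
  Real power of a nonnegative definite matrix through a unitary diagonalization
  \<open>A = U diag(d) U*\<close>.  One exists by the spectral theorem, and the resulting matrix does not
  depend on the choice of \<open>U\<close> and \<open>d\<close>.  For a singular \<open>A\<close> and \<open>a < 0\<close> the eigenvalue \<open>0\<close>
  contributes \<open>0 powr a = 0\<close>; a matrix weight is singular on a null set only.
\<close>

definition mat_powr :: "complex^'m^'m \<Rightarrow> real \<Rightarrow> complex^'m^'m" where
  "mat_powr A a = (THE B. \<exists>U d. unitary_matrix U \<and> (\<forall>i. 0 \<le> d i) \<and>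
      A = U ** diag_matrix d ** conj_transpose U \<and>
      B = U ** diag_matrix (\<lambda>i. d i powr a) ** conj_transpose U)"


section \<open>Cubes and averages\<close>

text \<open>A product of bounded intervals of common length \<open>l > 0\<close>, each containing or omitting
  either of its end points.\<close>

definition is_cube :: "(real^'n) set \<Rightarrow> bool" where
  "is_cube Q \<longleftrightarrow> (\<exists>(a::real^'n) l I. 0 < l \<and>
      (\<forall>i. {a$i<..<a$i + l} \<subseteq> I i \<and> I i \<subseteq> {a$i..a$i + l}) \<and>
      Q = {x. \<forall>i. x $ i \<in> I i})"

text \<open>Average of a real function; only used for functions that are integrable over \<open>E\<close>.\<close>

definition average :: "(real^'n) set \<Rightarrow> (real^'n \<Rightarrow> real) \<Rightarrow> real" where
  "average E f = (LINT x:E|lebesgue. f x) / measure lebesgue E"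

text \<open>
  Average of an extended real function, with values in \<open>[-\<infinity>, \<infinity>]\<close>, as the difference of the
  integrals of the positive and the negative part (\<^const>\<open>e2ennreal\<close> maps negative numbers
  to \<open>0\<close>).  The averages of logarithms have to be taken in this sense: the Bochner integral
  would assign \<open>0\<close> to a logarithm that fails to be integrable, whereas its average is then
  \<open>\<infinity>\<close> or \<open>-\<infinity>\<close>.
\<close>

definition ext_average :: "(real^'n) set \<Rightarrow> (real^'n \<Rightarrow> ereal) \<Rightarrow> ereal" where
  "ext_average E f =
     (enn2ereal (\<integral>\<^sup>+x\<in>E. e2ennreal (f x) \<partial>lebesgue)
      - enn2ereal (\<integral>\<^sup>+x\<in>E. e2ennreal (- f x) \<partial>lebesgue)) / ereal (measure lebesgue E)"

text \<open>Logarithm of a nonnegative real, with \<open>log 0 = -\<infinity>\<close>.\<close>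

definition ext_log :: "real \<Rightarrow> ereal" where
  "ext_log t = (if t = 0 then -\<infinity> else ereal (ln t))"

definition ext_exp :: "ereal \<Rightarrow> ereal" where
  "ext_exp s = (case s of ereal r \<Rightarrow> ereal (exp r) | PInfty \<Rightarrow> \<infinity> | MInfty \<Rightarrow> 0)"

text \<open>Since \<open>ln 0 = 0\<close> in HOL, this also gives the right value \<open>0\<close> at \<open>t = 0\<close>.\<close>

definition log_plus :: "real \<Rightarrow> real" where
  "log_plus t = max 0 (ln t)"


section \<open>Matrix weights\<close>

definition matrix_weight :: "(real^'n \<Rightarrow> complex^'m^'m) \<Rightarrow> bool" where
  "matrix_weight W \<longleftrightarrow>
     (\<forall>x. nonneg_definite (W x)) \<and>
     (AE x in lebesgue. invertible (W x)) \<and>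
     (\<forall>i j K. compact K \<longrightarrow> (\<lambda>x. W x $ i $ j) absolutely_integrable_on K)"

text \<open>\<open>weight_mean p W E z\<close> is the weighted \<open>L\<^sup>p\<close> mean of the constant vector \<open>z\<close> over \<open>E\<close>.
  Its integrand is at most \<open>\<parallel>W x\<parallel> |z| powr p\<close>, hence integrable over bounded sets when \<open>W\<close> is
  a matrix weight.\<close>

definition weight_mean ::
    "real \<Rightarrow> (real^'n \<Rightarrow> complex^'m^'m) \<Rightarrow> (real^'n) set \<Rightarrow> complex^'m \<Rightarrow> real" where
  "weight_mean p W E z =
     average E (\<lambda>x. norm (mat_powr (W x) (1/p) *v z) powr p) powr (1/p)"

text \<open>\<open>c\<close> and \<open>C\<close> are the lower and upper equivalence constants.\<close>

definition reducing_operator ::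
    "real \<Rightarrow> real \<Rightarrow> real \<Rightarrow> (real^'n \<Rightarrow> complex^'m^'m) \<Rightarrow> (real^'n) set
       \<Rightarrow> complex^'m^'m \<Rightarrow> bool" where
  "reducing_operator c C p W E A \<longleftrightarrow>
     bounded E \<and> E \<in> sets lebesgue \<and> 0 < measure lebesgue E \<and> pos_definite A \<and>
     (\<forall>z. c * weight_mean p W E z \<le> norm (A *v z) \<and>
          norm (A *v z) \<le> C * weight_mean p W E z)"

text \<open>The inner average over \<open>x\<close> in the definition of \<open>A\<^sub>p\<^sub>,\<^sub>\<infinity>\<close>, as a function of \<open>y\<close>.  Again the
  integrand is dominated by a multiple of \<open>\<parallel>W x\<parallel>\<close>.\<close>

definition weight_osc ::
    "real \<Rightarrow> (real^'n \<Rightarrow> complex^'m^'m) \<Rightarrow> (real^'n) set \<Rightarrow> real^'n \<Rightarrow> real" where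
  "weight_osc p W Q y =
     average Q (\<lambda>x. opnorm (mat_powr (W x) (1/p) ** mat_powr (W y) (-1/p)) powr p)"

definition Ap_infty_const :: "real \<Rightarrow> (real^'n \<Rightarrow> complex^'m^'m) \<Rightarrow> ereal" where
  "Ap_infty_const p W =
     (SUP Q\<in>{Q. is_cube Q}. ext_exp (ext_average Q (\<lambda>y. ext_log (weight_osc p W Q y))))"

definition Ap_infty :: "real \<Rightarrow> (real^'n \<Rightarrow> complex^'m^'m) \<Rightarrow> bool" where
  "Ap_infty p W \<longleftrightarrow> matrix_weight W \<and>
     (\<forall>Q. is_cube Q \<longrightarrow> set_integrable lebesgue Q (\<lambda>y. log_plus (weight_osc p W Q y))) \<and>
     Ap_infty_const p W < \<infinity>"

definition Ap_infty_tilde :: "real \<Rightarrow> (real^'n \<Rightarrow> complex^'m^'m) \<Rightarrow> bool" where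
  "Ap_infty_tilde p W \<longleftrightarrow> matrix_weight W \<and>
     (\<exists>C>0. \<forall>Q z. is_cube Q \<longrightarrow>
        ext_exp (ext_average Q (\<lambda>x. ext_log (norm (mat_powr (W x) (-1/p) *v z))))
        \<le> ereal C * (SUP u\<in>UNIV - {0}.
              ereal (cmod (cinner_vec z u) *
                average Q (\<lambda>x. norm (mat_powr (W x) (1/p) *v u) powr p) powr (-1/p))))"

end

theory Submission
  imports Defs
begin

text \<open>
  Write \<open>B(x) = W\<^sup>-\<^sup>1\<^sup>/\<^sup>p(x)\<close>, \<open>R(x) = W\<^sup>1\<^sup>/\<^sup>p(x)\<close> and let \<open>A\<close> be the reducing operator of a cube
  \<open>Q\<close>. For almost every \<open>x\<close> and every matrix \<open>M\<close>,
  \<open>\<parallel>A\<^sup>-\<^sup>1M\<parallel> \<le> \<parallel>R(x)A\<^sup>-\<^sup>1\<parallel> \<parallel>B(x)M\<parallel>\<close>, so the negative part of \<open>log (\<parallel>B(x)M\<parallel> / \<parallel>A\<^sup>-\<^sup>1M\<parallel>)\<close> is at most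
  \<open>log\<^sub>+ \<parallel>R(x)A\<^sup>-\<^sup>1\<parallel> \<le> \<parallel>R(x)A\<^sup>-\<^sup>1\<parallel>\<^sup>p / p\<close>, whose average over \<open>Q\<close> is bounded by a constant independent
  of \<open>Q\<close> because \<open>A\<close> is reducing. Hence \<open>log\<close> and \<open>log\<^sub>+\<close> are interchangeable in all the conditions.
  Vectors and matrices are interchangeable by passing to columns, and the inner average in (vi) and
  (vii) is comparable to \<open>\<parallel>B(y)A\<parallel>\<^sup>p\<close>. Finally, the supremum in (i) is comparable to
  \<open>|A\<^sup>-\<^sup>1z|\<close>, attained up to constants at \<open>u = A\<^sup>-\<^sup>2z\<close>.
\<close>

subsection \<open>The operator norm\<close>

text \<open>Averages of logarithms are extended real, whereas the estimates concern integrable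
  functions. An integrable bound on the negative part excludes infinity minus infinity, so that each
  condition can be restated as integrability together with a bound on an ordinary average. A second
  obstacle is measurability: \<open>mat_powr\<close> comes from a unitary diagonalization, which
  offers no measurable choice of eigenvectors in \<open>x\<close>. The powers are therefore obtained
  as pointwise limits of polynomials in \<open>W x\<close>, and the spectral theorem identifies
  these limits. The powers of \<open>W x\<close>, the reducing operator and its inverse are all
  Hermitian. Adjoints thus exchange the order of factors wherever the reducing property controls
  \<open>A ** B x\<close> but a condition speaks of \<open>B x ** A\<close>. The comparison
  constants involve only the dimension, \<open>p\<close>, \<open>c1\<close> and \<open>c2\<close>;
  the powers of the dimension are the price of passing to columns.\<close>

lemma norm_matrix_vector_mult_le:
  fixes A :: "complex^'m^'n"
  shows "norm (A *v z) \<le> norm A * norm z"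
proof -
  have "norm ((A *v z) $ i) \<le> norm (A $ i) * norm z" for i
  proof -
    have "norm ((A *v z) $ i) \<le> (\<Sum>j\<in>UNIV. norm (A $ i $ j) * norm (z $ j))"
      by (simp add: matrix_vector_mult_def norm_mult sum_norm_le)
    also have "\<dots> \<le> L2_set (\<lambda>j. norm (A $ i $ j)) UNIV * L2_set (\<lambda>j. norm (z $ j)) UNIV"
      using L2_set_mult_ineq[of "\<lambda>j. norm (A $ i $ j)" "\<lambda>j. norm (z $ j)" UNIV] by simp
    finally show ?thesis
      by (simp add: norm_vec_def)
  qed
  then have "norm (A *v z) \<le> L2_set (\<lambda>i. norm (A $ i) * norm z) UNIV"
    unfolding norm_vec_def[of "A *v z"] by (intro L2_set_mono) auto
  also have "\<dots> = norm A * norm z"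
    by (simp add: norm_vec_def[of A] L2_set_left_distrib)
  finally show ?thesis .
qed

lemma norm_le_opnorm: "norm (A *v z) \<le> opnorm A * norm z"
  unfolding opnorm_def by (rule onorm) simp

lemma opnorm_bound: "(\<And>z. norm (A *v z) \<le> b * norm z) \<Longrightarrow> opnorm A \<le> b"
  unfolding opnorm_def by (rule onorm_le) auto

lemma opnorm_nonneg: "0 \<le> opnorm A"
  unfolding opnorm_def by (rule onorm_pos_le) simp

lemma opnorm_le_norm: "opnorm A \<le> norm A"
  by (rule opnorm_bound) (rule norm_matrix_vector_mult_le)

lemma opnorm_mult: "opnorm (A ** B) \<le> opnorm A * opnorm B"
proof (rule opnorm_bound)
  fix z
  have "norm ((A ** B) *v z) \<le> opnorm A * norm (B *v z)"
    by (metis matrix_vector_mul_assoc norm_le_opnorm)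
  also have "\<dots> \<le> opnorm A * (opnorm B * norm z)"
    by (intro mult_left_mono norm_le_opnorm opnorm_nonneg)
  finally show "norm ((A ** B) *v z) \<le> opnorm A * opnorm B * norm z"
    by simp
qed

lemma opnorm_add: "opnorm (A + B) \<le> opnorm A + opnorm B"
  unfolding opnorm_def matrix_vector_mult_add_rdistrib
  by (rule onorm_triangle) simp_all

lemma opnorm_mat_1: "opnorm (mat 1 :: complex^'m^'m) = 1"
proof -
  have "(\<lambda>z. (mat 1 :: complex^'m^'m) *v z) = (\<lambda>z. z)"
    by (simp add: fun_eq_iff)
  then show ?thesis
    by (simp add: opnorm_def onorm_id)
qed

lemma opnorm_eq_0: "opnorm A = 0 \<longleftrightarrow> A = 0"
proof
  assume "opnorm A = 0"
  then have "A *v z = 0" for z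
    using norm_le_opnorm[of A z] by simp
  then show "A = 0"
    by (simp add: matrix_eq)
qed (use opnorm_le_norm[of A] opnorm_nonneg[of A] in auto)

lemma opnorm_minus_commute: "opnorm (A - B) = opnorm (B - A)"
proof -
  have "norm ((A - B) *v z) = norm ((B - A) *v z)" for z
    by (metis matrix_vector_mult_diff_rdistrib norm_minus_commute)
  then show ?thesis
    by (metis norm_le_opnorm opnorm_bound order_antisym)
qed

text \<open>The triangle inequality and \<open>opnorm_le_norm\<close> give Lipschitz constant 1 for
  the Euclidean norm on matrices. Continuity is needed for the measurability of operator norms of
  matrix functions.\<close>

lemma continuous_on_opnorm: "continuous_on UNIV opnorm"
proof (rule continuous_on_iff[THEN iffD2], intro ballI allI impI)
  fix A :: "complex^'m^'m" and e :: real
  assume "0 < e"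
  have "dist (opnorm B) (opnorm A) \<le> dist B A" for B
  proof -
    have "opnorm B \<le> opnorm (B - A) + opnorm A" "opnorm A \<le> opnorm (A - B) + opnorm B"
      using opnorm_add[of "B - A" A] opnorm_add[of "A - B" B] by simp_all
    then show ?thesis
      using opnorm_le_norm[of "B - A"] opnorm_minus_commute[of A B] by (simp add: dist_norm)
  qed
  then show "\<exists>d>0. \<forall>B\<in>UNIV. dist B A < d \<longrightarrow> dist (opnorm B) (opnorm A) < e"
    using \<open>0 < e\<close> by (meson le_less_trans)
qed

lemma norm_smult_complex: "norm (c *s v) = cmod c * norm v" for v :: "complex^'m"
  by (simp add: norm_vec_def norm_mult L2_set_right_distrib)

lemma matrix_vector_mult_axis: "A *v axis j 1 = column j (A :: complex^'m^'n)"
  by (simp add: matrix_vector_mult_def column_def vec_eq_iff axis_def if_distrib cong: if_cong)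

lemma matrix_vector_mult_scaleR_complex: "A *v (r *\<^sub>R z) = r *\<^sub>R (A *v z)"
  for A :: "complex^'m^'n"
  by (rule linear_scale) simp

lemma opnorm_ge_column: "norm (A *v axis j 1) \<le> opnorm A"
  using norm_le_opnorm[of A "axis j 1"] by simp

text \<open>Expand \<open>z\<close> in the standard basis and use that each coordinate is at most
  \<open>norm z\<close>. This is the passage from matrices to vectors on which the matrix conditions
  rest.\<close>

lemma opnorm_le_sum_columns:
  fixes A :: "complex^'m^'m"
  shows "opnorm A \<le> (\<Sum>j\<in>UNIV. norm (A *v axis j 1))"
proof (rule opnorm_bound)
  fix z :: "complex^'m"
  have "A *v z = (\<Sum>j\<in>UNIV. z $ j *s (A *v axis j 1))"
    unfolding matrix_vector_mult_axis by (rule matrix_mult_sum)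
  also have "norm \<dots> \<le> (\<Sum>j\<in>UNIV. norm (z $ j *s (A *v axis j 1)))"
    by (rule norm_sum)
  also have "\<dots> \<le> (\<Sum>j\<in>UNIV. norm (A *v axis j 1) * norm z)"
  proof (rule sum_mono)
    fix j
    show "norm (z $ j *s (A *v axis j 1)) \<le> norm (A *v axis j 1) * norm z"
      using Finite_Cartesian_Product.norm_nth_le[of z j] by (simp add: norm_smult_complex mult.commute mult_right_mono)
  qed
  finally show "norm (A *v z) \<le> (\<Sum>j\<in>UNIV. norm (A *v axis j 1)) * norm z"
    by (simp add: sum_distrib_right)
qed

subsection \<open>The spectral theorem\<close>

lemma inner_eq_cinner_vec: "inner z u = Re (cinner_vec z u)"
  by (simp add: inner_vec_def cinner_vec_def inner_complex_def)

lemma cinner_vec_self: "cinner_vec z z = complex_of_real ((norm z)\<^sup>2)"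
proof -
  have "cinner_vec z z = (\<Sum>i\<in>UNIV. complex_of_real ((cmod (z $ i))\<^sup>2))"
    unfolding cinner_vec_def by (intro sum.cong refl complex_norm_square[symmetric])
  then show ?thesis
    by (simp add: norm_vec_def L2_set_def sum_nonneg)
qed

lemma cinner_vec_commute: "cinner_vec u z = cnj (cinner_vec z u)"
  by (simp add: cinner_vec_def mult.commute)

lemma cinner_vec_add_left: "cinner_vec (x + y) z = cinner_vec x z + cinner_vec y z"
  and cinner_vec_add_right: "cinner_vec z (x + y) = cinner_vec z x + cinner_vec z y"
  and cinner_vec_diff_left: "cinner_vec (x - y) z = cinner_vec x z - cinner_vec y z"
  and cinner_vec_scale_left: "cinner_vec (c *s x) z = c * cinner_vec x z"
  and cinner_vec_scale_right: "cinner_vec z (c *s x) = cnj c * cinner_vec z x"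
  by (simp_all add: cinner_vec_def algebra_simps sum.distrib sum_subtractf sum_distrib_left)

lemma cinner_vec_zero [simp]: "cinner_vec 0 z = 0" "cinner_vec z 0 = 0"
  by (simp_all add: cinner_vec_def)

lemma cmod_cinner_vec_le: "cmod (cinner_vec z u) \<le> norm z * norm u"
proof -
  have "cmod (cinner_vec z u) \<le> (\<Sum>i\<in>UNIV. cmod (z $ i) * cmod (u $ i))"
    unfolding cinner_vec_def by (intro sum_norm_le) (simp add: norm_mult)
  also have "\<dots> \<le> norm z * norm u"
    using L2_set_mult_ineq[of "\<lambda>i. cmod (z $ i)" "\<lambda>i. cmod (u $ i)" UNIV]
    by (simp add: norm_vec_def)
  finally show ?thesis .
qed

lemma cinner_vec_conj_transpose: "cinner_vec (A *v z) u = cinner_vec z (conj_transpose A *v u)"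
proof -
  have "cinner_vec (A *v z) u = (\<Sum>i\<in>UNIV. \<Sum>j\<in>UNIV. A $ i $ j * z $ j * cnj (u $ i))"
    by (simp add: cinner_vec_def matrix_vector_mult_def sum_distrib_right)
  also have "\<dots> = (\<Sum>j\<in>UNIV. \<Sum>i\<in>UNIV. A $ i $ j * z $ j * cnj (u $ i))"
    by (rule sum.swap)
  also have "\<dots> = cinner_vec z (conj_transpose A *v u)"
    by (simp add: cinner_vec_def matrix_vector_mult_def conj_transpose_def sum_distrib_left mult_ac)
  finally show ?thesis .
qed

lemma conj_transpose_conj_transpose [simp]: "conj_transpose (conj_transpose A) = A"
  by (simp add: conj_transpose_def vec_eq_iff)

lemma conj_transpose_mult: "conj_transpose (A ** B) = conj_transpose B ** conj_transpose A"
  by (simp add: conj_transpose_def matrix_matrix_mult_def vec_eq_iff mult.commute)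

lemma conj_transpose_diag_matrix [simp]: "conj_transpose (diag_matrix d) = diag_matrix d"
  by (simp add: conj_transpose_def diag_matrix_def vec_eq_iff)

lemma conj_transpose_mat_1 [simp]: "conj_transpose (mat 1) = mat 1"
  by (simp add: conj_transpose_def mat_def vec_eq_iff)

text \<open>With \<open>w\<close> the adjoint applied to \<open>z\<close>, the square of
  \<open>norm w\<close> is the form of \<open>A *v w\<close> against \<open>z\<close>, hence at most
  \<open>opnorm A * norm w * norm z\<close>; cancel \<open>norm w\<close>. The reverse inequality is
  the same one for the adjoint.\<close>

lemma opnorm_conj_transpose: "opnorm (conj_transpose A) = opnorm A"
proof -
  have *: "opnorm (conj_transpose A) \<le> opnorm A" for A :: "complex^'m^'m"
  proof (rule opnorm_bound)
    fix z
    let ?w = "conj_transpose A *v z"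
    have "(norm ?w)\<^sup>2 = cmod (cinner_vec (A *v ?w) z)"
      by (simp add: cinner_vec_conj_transpose cinner_vec_self norm_power)
    also have "\<dots> \<le> norm (A *v ?w) * norm z"
      by (rule cmod_cinner_vec_le)
    also have "\<dots> \<le> opnorm A * norm ?w * norm z"
      by (intro mult_right_mono norm_le_opnorm) simp
    finally have "norm ?w * norm ?w \<le> (opnorm A * norm z) * norm ?w"
      by (simp add: power2_eq_square mult_ac)
    then show "norm ?w \<le> opnorm A * norm z"
      by (cases "norm ?w = 0") (auto simp: opnorm_nonneg mult_le_cancel_right)
  qed
  show ?thesis
    using *[of A] *[of "conj_transpose A"] by simp
qed

text \<open>Polarization: reality of the form at \<open>u + v\<close> makes the imaginary parts of
  \<open>g u v\<close> and \<open>g v u\<close> opposite, and reality at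
  \<open>u + \<i> *s v\<close> makes their real parts equal.\<close>

lemma hermitian_if_form_real:
  assumes real: "\<And>z. cinner_vec (A *v z) z \<in> \<real>"
  shows "conj_transpose A = A"
proof -
  define g where "g u v = cinner_vec (A *v u) v" for u v
  have sym: "g u v = cnj (g v u)" for u v
  proof -
    have "g (u + v) (u + v) = g u u + g v v + (g u v + g v u)"
      by (simp add: g_def matrix_vector_right_distrib cinner_vec_add_left cinner_vec_add_right)
    moreover have "g (u + \<i> *s v) (u + \<i> *s v) = g u u + g v v + \<i> * (g v u - g u v)"
      by (simp add: g_def matrix_vector_right_distrib vector_scalar_commute
          cinner_vec_add_left cinner_vec_add_right cinner_vec_scale_left cinner_vec_scale_right
          algebra_simps)
    ultimately show ?thesis
      using real[folded g_def, of u] real[folded g_def, of v] real[folded g_def, of "u + v"]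
        real[folded g_def, of "u + \<i> *s v"]
      by (auto simp: complex_is_Real_iff complex_eq_iff)
  qed
  have "cinner_vec z (conj_transpose A *v u - A *v u) = 0" for z u
  proof -
    have "cinner_vec z (conj_transpose A *v u) = cinner_vec z (A *v u)"
      using sym[of z u] by (metis g_def cinner_vec_conj_transpose cinner_vec_commute)
    then show ?thesis
      by (metis cinner_vec_commute cinner_vec_diff_left complex_cnj_diff right_minus_eq)
  qed
  then have "conj_transpose A *v u - A *v u = 0" for u
    using cinner_vec_self[of "conj_transpose A *v u - A *v u"] by simp
  then show ?thesis
    by (simp add: matrix_eq)
qed

text \<open>A maximizer of the Rayleigh quotient on the unit sphere of an invariant subspace is an
  eigenvector.\<close>

lemma eigenvector_in_invariant_subspace:
  fixes A :: "complex^'m^'m" and S :: "(complex^'m) set"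
  assumes herm: "conj_transpose A = A"
    and S: "subspace S" and inv: "\<And>z. z \<in> S \<Longrightarrow> A *v z \<in> S" and ne: "\<exists>z\<in>S. z \<noteq> 0"
  obtains w l where "w \<in> S" "norm w = 1" "A *v w = l *\<^sub>R w"
proof -
  \<comment> \<open>Only real scalars enter the variational argument, so the real inner product and
    a real subspace \<open>S\<close> suffice.\<close>
  define q where "q z = inner (A *v z) z" for z
  have sym: "inner (A *v u) v = inner u (A *v v)" for u v
    by (simp add: inner_eq_cinner_vec cinner_vec_conj_transpose herm)
  have "compact (S \<inter> sphere 0 1)"
    by (simp add: closed_subspace S closed_Int_compact)
  moreover have "S \<inter> sphere 0 1 \<noteq> {}"
  proof -
    obtain z where "z \<in> S" "z \<noteq> 0"
      using ne by blast
    then have "(1 / norm z) *\<^sub>R z \<in> S \<inter> sphere 0 1"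
      using subspace_scale[OF S] by auto
    then show ?thesis by blast
  qed
  moreover have "continuous_on (S \<inter> sphere 0 1) q"
    unfolding q_def by (intro continuous_intros linear_continuous_on) simp
  ultimately obtain w where w: "w \<in> S" "norm w = 1"
    and max: "\<And>z. z \<in> S \<Longrightarrow> norm z = 1 \<Longrightarrow> q z \<le> q w"
    using continuous_attains_sup[of "S \<inter> sphere 0 1" q] by (metis IntD1 IntD2 IntI mem_sphere_0)
  \<comment> \<open>The residual of the eigenvalue equation at the maximizer; the goal is that it
    vanishes.\<close>
  define v where "v = A *v w - q w *\<^sub>R w"
  have bound: "q z \<le> q w * (norm z)\<^sup>2" if "z \<in> S" for z
  proof (cases "z = 0")
    case False
    have "q ((1 / norm z) *\<^sub>R z) \<le> q w"
      using False that subspace_scale[OF S] by (intro max) auto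
    moreover have "q ((1 / norm z) *\<^sub>R z) = q z / (norm z)\<^sup>2"
      by (simp add: q_def matrix_vector_mult_scaleR_complex power2_eq_square)
    ultimately show ?thesis
      using False by (simp add: field_simps)
  qed (simp add: q_def)
  have vS: "v \<in> S"
    unfolding v_def by (intro subspace_diff S inv subspace_scale w)
  define c where "c = q v - q w * (norm v)\<^sup>2"
  \<comment> \<open>Maximality tested along the line through \<open>w\<close> in direction
    \<open>v\<close>. The first-order term is exactly twice the squared norm of the
    residual.\<close>
  have ineq: "2 * t * (norm v)\<^sup>2 + t\<^sup>2 * c \<le> 0" for t
  proof -
    have "q (w + t *\<^sub>R v) \<le> q w * (norm (w + t *\<^sub>R v))\<^sup>2"
      by (intro bound subspace_add S w subspace_scale vS)
    moreover have "q (w + t *\<^sub>R v) = q w + 2 * t * inner (A *v w) v + t\<^sup>2 * q v"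
      by (simp add: q_def matrix_vector_right_distrib matrix_vector_mult_scaleR_complex inner_add_left
          inner_add_right sym[of v w] inner_commute[of v "A *v w"] power2_eq_square algebra_simps)
    moreover have "(norm (w + t *\<^sub>R v))\<^sup>2 = 1 + 2 * t * inner w v + t\<^sup>2 * (norm v)\<^sup>2"
      using w unfolding power2_norm_eq_inner norm_eq_1
      by (simp add: inner_add_left inner_add_right inner_commute[of v w] power2_eq_square
          algebra_simps)
    moreover have "inner (A *v w) v = (norm v)\<^sup>2 + q w * inner w v"
      by (simp add: power2_norm_eq_inner inner_diff_left v_def)
    ultimately have "q w + 2 * t * ((norm v)\<^sup>2 + q w * inner w v) + t\<^sup>2 * q v
      \<le> q w * (1 + 2 * t * inner w v + t\<^sup>2 * (norm v)\<^sup>2)"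
      by metis
    then show ?thesis
      by (simp add: c_def algebra_simps)
  qed
  have "norm v = 0"
  proof (rule ccontr)
    assume "norm v \<noteq> 0"
    then have n: "0 < (norm v)\<^sup>2" by simp
    \<comment> \<open>A step small enough that the quadratic term cannot cancel more than half of
      the linear one.\<close>
    define t where "t = (norm v)\<^sup>2 / (1 + \<bar>c\<bar>)"
    have t: "0 < t" using n by (simp add: t_def)
    have "t * - c \<le> t * (1 + \<bar>c\<bar>)"
      using t by (intro mult_left_mono) auto
    then have "- (t * c) \<le> (norm v)\<^sup>2"
      by (simp add: t_def)
    moreover have "t * (2 * (norm v)\<^sup>2 + t * c) \<le> 0"
      using ineq[of t] by (simp add: algebra_simps power2_eq_square)
    ultimately show False
      using t n by (simp add: mult_le_0_iff)
  qed
  then have "A *v w = q w *\<^sub>R w"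
    by (simp add: v_def)
  with w show thesis
    by (rule that)
qed

text \<open>Eigenvectors are indexed by subsets of the coordinate type, so that the full index set
  yields a basis. The orthogonal complement of the vectors found so far is invariant because
  \<open>A\<close> is Hermitian, and it contains the next eigenvector.\<close>

lemma orthonormal_eigenvectors:
  fixes A :: "complex^'m^'m" and I :: "'m set"
  assumes herm: "conj_transpose A = A"
  shows "finite I \<Longrightarrow> \<exists>e l. \<forall>i\<in>I. A *v e i = l i *\<^sub>R e i \<and>
    (\<forall>j\<in>I. cinner_vec (e i) (e j) = (if i = j then 1 else 0))"
proof (induction I rule: finite_induct)
  case (insert k I)
  then obtain e :: "'m \<Rightarrow> complex^'m" and l :: "'m \<Rightarrow> real" where el: "\<And>i. i \<in> I \<Longrightarrow> A *v e i = l i *\<^sub>R e i"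
    "\<And>i j. i \<in> I \<Longrightarrow> j \<in> I \<Longrightarrow> cinner_vec (e i) (e j) = (if i = j then 1 else 0)"
    by blast
  define S where "S = {z. \<forall>i\<in>I. cinner_vec z (e i) = 0}"
  have scaleR: "r *\<^sub>R z = complex_of_real r *s z" for r and z :: "complex^'m"
    by (simp only: vec_eq_iff vector_scaleR_component vector_smult_component)
      (simp add: scaleR_conv_of_real)
  have S: "subspace S"
    unfolding S_def by (auto intro!: subspaceI simp: cinner_vec_add_left scaleR cinner_vec_scale_left)
  have inv: "A *v z \<in> S" if "z \<in> S" for z
    using that el(1)
    by (simp add: S_def cinner_vec_conj_transpose herm scaleR cinner_vec_scale_right)
  have "\<exists>z\<in>S. z \<noteq> 0"
  proof -
    \<comment> \<open>Dimension count: \<open>f\<close> never reaches \<open>axis k 1\<close>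
      because its \<open>k\<close>-th coordinate is always 0. A linear self-map that is not onto is
      not injective, and its kernel lies in \<open>S\<close>.\<close>
    define f where "f z = (\<chi> i. if i \<in> I then cinner_vec z (e i) else 0)" for z
    have lin: "linear f"
      by (rule linearI) (auto simp: f_def vec_eq_iff cinner_vec_add_left scaleR cinner_vec_scale_left)
    have "axis k 1 \<notin> range f"
    proof
      assume "axis k 1 \<in> range f"
      then obtain z where "f z = axis k 1" by (metis imageE)
      then have "f z $ k = axis k 1 $ k" by simp
      then show False
        using insert.hyps by (simp add: f_def)
    qed
    then have "\<not> inj f"
      using linear_inj_imp_surj[OF lin] by blast
    then obtain z where "z \<noteq> 0" "f z = 0"
      using linear_injective_0[OF lin] by blast
    then have "z \<in> S"
      by (simp add: S_def f_def vec_eq_iff) meson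
    with \<open>z \<noteq> 0\<close> show ?thesis by blast
  qed
  then obtain w r where w: "w \<in> S" "norm w = 1" "A *v w = r *\<^sub>R w"
    using eigenvector_in_invariant_subspace[OF herm S inv] by blast
  have "cinner_vec w w = 1"
    using w by (simp add: cinner_vec_self)
  moreover have "cinner_vec w (e i) = 0" "cinner_vec (e i) w = 0" if "i \<in> I" for i
    using w that cinner_vec_commute[of "e i" w] by (simp_all add: S_def)
  ultimately have "\<forall>i\<in>insert k I. A *v (e(k := w)) i = (l(k := r)) i *\<^sub>R (e(k := w)) i \<and>
    (\<forall>j\<in>insert k I. cinner_vec ((e(k := w)) i) ((e(k := w)) j) = (if i = j then 1 else 0))"
    using el w insert.hyps by auto
  then show ?case by blast
qed auto

theorem spectral_theorem:
  fixes A :: "complex^'m^'m"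
  assumes herm: "conj_transpose A = A"
  obtains U d where "unitary_matrix U" "A = U ** diag_matrix d ** conj_transpose U"
proof -
  obtain e :: "'m \<Rightarrow> complex^'m" and d :: "'m \<Rightarrow> real" where e: "\<And>i. A *v e i = d i *\<^sub>R e i"
    "\<And>i j. cinner_vec (e i) (e j) = (if i = j then 1 else 0)"
    using orthonormal_eigenvectors[OF herm finite_class.finite_UNIV] by auto
  define U where "U = (\<chi> i j. e j $ i)"
  have "(conj_transpose U ** U) $ i $ j = cinner_vec (e j) (e i)" for i j
    by (simp add: U_def conj_transpose_def matrix_matrix_mult_def cinner_vec_def mult.commute)
  then have UU: "conj_transpose U ** U = mat 1"
    by (simp add: vec_eq_iff e mat_def)
  then have UU': "U ** conj_transpose U = mat 1"
    using matrix_left_right_inverse by blast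
  have "(A ** U) $ i $ j = (A *v e j) $ i" for i j
    by (simp add: U_def matrix_matrix_mult_def matrix_vector_mult_def)
  moreover have "(U ** diag_matrix d) $ i $ j = (d j *\<^sub>R e j) $ i" for i j
  proof -
    have "(U ** diag_matrix d) $ i $ j = (\<Sum>k\<in>UNIV. if k = j then e j $ i * complex_of_real (d j) else 0)"
      unfolding matrix_matrix_mult_def U_def diag_matrix_def vec_lambda_beta
      by (intro sum.cong) simp_all
    also have "\<dots> = e j $ i * complex_of_real (d j)"
      by (simp only: sum.delta finite_class.finite_UNIV UNIV_I if_True)
    finally show ?thesis
      by (simp only: vector_scaleR_component scaleR_conv_of_real[where 'a=complex] mult.commute)
  qed
  ultimately have "A ** U = U ** diag_matrix d"
    by (simp add: vec_eq_iff e)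
  then have "A = U ** diag_matrix d ** conj_transpose U"
    by (metis UU' matrix_mul_assoc matrix_mul_rid)
  with UU UU' show thesis
    by (intro that[of U d]) (simp_all add: unitary_matrix_def)
qed

subsection \<open>Powers of nonnegative definite matrices\<close>

lemma diag_matrix_mult_left: "(diag_matrix d ** T) $ i $ j = complex_of_real (d i) * T $ i $ j"
proof -
  have "(diag_matrix d ** T) $ i $ j
      = (\<Sum>k\<in>UNIV. if i = k then complex_of_real (d i) * T $ i $ j else 0)"
    unfolding matrix_matrix_mult_def diag_matrix_def vec_lambda_beta
    by (intro sum.cong) simp_all
  then show ?thesis by simp
qed

lemma diag_matrix_mult_right: "(T ** diag_matrix d) $ i $ j = T $ i $ j * complex_of_real (d j)"
proof -
  have "(T ** diag_matrix d) $ i $ j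
      = (\<Sum>k\<in>UNIV. if k = j then T $ i $ j * complex_of_real (d j) else 0)"
    unfolding matrix_matrix_mult_def diag_matrix_def vec_lambda_beta
    by (intro sum.cong) simp_all
  then show ?thesis by simp
qed

lemma diag_matrix_mult: "diag_matrix d ** diag_matrix e = diag_matrix (\<lambda>i. d i * e i)"
  by (simp add: vec_eq_iff diag_matrix_mult_left) (simp add: diag_matrix_def)

lemma diag_matrix_mult_vec: "(diag_matrix d *v z) $ i = complex_of_real (d i) * z $ i"
  by (simp add: matrix_vector_mult_def diag_matrix_def if_distrib if_distribR cong: if_cong)

lemma diag_matrix_1: "diag_matrix (\<lambda>i. 1) = mat 1"
  by (simp add: diag_matrix_def mat_def vec_eq_iff)

text \<open>The spectral form of a matrix, named so that a function of the matrix becomes a function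
  applied to \<open>d\<close>.\<close>

definition unitary_conj :: "complex^'m^'m \<Rightarrow> ('m \<Rightarrow> real) \<Rightarrow> complex^'m^'m" where
  "unitary_conj U d = U ** diag_matrix d ** conj_transpose U"

lemma unitary_conj_component:
  "unitary_conj U d $ i $ j = (\<Sum>k\<in>UNIV. U $ i $ k * complex_of_real (d k) * cnj (U $ j $ k))"
  unfolding unitary_conj_def matrix_matrix_mult_def[of "U ** diag_matrix d"]
  by (simp add: diag_matrix_mult_right) (simp add: conj_transpose_def)

lemma unitary_conj_mult:
  assumes "unitary_matrix U"
  shows "unitary_conj U d ** unitary_conj U e = unitary_conj U (\<lambda>i. d i * e i)"
proof -
  have "unitary_conj U d ** unitary_conj U e
      = U ** diag_matrix d ** (conj_transpose U ** U) ** diag_matrix e ** conj_transpose U"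
    by (simp add: unitary_conj_def matrix_mul_assoc)
  also have "\<dots> = U ** (diag_matrix d ** diag_matrix e) ** conj_transpose U"
    using assms by (simp add: unitary_matrix_def matrix_mul_assoc)
  finally show ?thesis
    by (simp add: unitary_conj_def diag_matrix_mult)
qed

lemma unitary_conj_1: "unitary_matrix U \<Longrightarrow> unitary_conj U (\<lambda>i. 1) = mat 1"
  by (simp add: unitary_conj_def diag_matrix_1 unitary_matrix_def)

lemma conj_transpose_unitary_conj [simp]: "conj_transpose (unitary_conj U d) = unitary_conj U d"
  by (simp add: unitary_conj_def conj_transpose_mult matrix_mul_assoc)

lemma norm_unitary_mult:
  assumes "conj_transpose U ** U = mat 1"
  shows "norm (U *v z) = norm z"
proof -
  have "complex_of_real ((norm (U *v z))\<^sup>2) = complex_of_real ((norm z)\<^sup>2)"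
    unfolding cinner_vec_self[symmetric] cinner_vec_conj_transpose matrix_vector_mul_assoc assms
    by simp
  then show ?thesis
    by (simp only: of_real_eq_iff power2_eq_iff_nonneg norm_ge_zero)
qed

text \<open>The transition matrix \<open>T\<close> intertwines the two diagonals, so its entry at
  \<open>i\<close>, \<open>j\<close> vanishes unless \<open>d j = e i\<close>; hence it also
  intertwines the diagonals after applying \<open>f\<close>. This independence of the
  diagonalization is the uniqueness behind the description in \<open>mat_powr\<close>.\<close>

lemma unitary_conj_cong:
  assumes U: "unitary_matrix U" and V: "unitary_matrix V"
    and eq: "unitary_conj U d = unitary_conj V e"
  shows "unitary_conj U (\<lambda>i. f (d i)) = unitary_conj V (\<lambda>i. f (e i))"
proof -
  define T where "T = conj_transpose V ** U"
  have VV: "conj_transpose V ** V = mat 1" "V ** conj_transpose V = mat 1"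
    and UU: "conj_transpose U ** U = mat 1" "U ** conj_transpose U = mat 1"
    using U V by (auto simp: unitary_matrix_def)
  have "T ** diag_matrix d = conj_transpose V ** unitary_conj U d ** U"
    by (metis (no_types) T_def UU(1) matrix_mul_assoc matrix_mul_rid unitary_conj_def)
  also have "\<dots> = diag_matrix e ** T"
    unfolding eq by (metis (no_types) T_def VV(1) matrix_mul_assoc matrix_mul_lid unitary_conj_def)
  finally have "T $ i $ j * complex_of_real (d j) = complex_of_real (e i) * T $ i $ j" for i j
    by (metis diag_matrix_mult_left diag_matrix_mult_right)
  then have "T $ i $ j = 0 \<or> d j = e i" for i j
    by (metis mult.commute mult_cancel_left of_real_eq_iff)
  then have "(T ** diag_matrix (\<lambda>i. f (d i))) $ i $ j = (diag_matrix (\<lambda>i. f (e i)) ** T) $ i $ j" for i j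
    by (metis diag_matrix_mult_left diag_matrix_mult_right mult.commute mult_zero_left)
  then have "T ** diag_matrix (\<lambda>i. f (d i)) = diag_matrix (\<lambda>i. f (e i)) ** T"
    by (simp add: vec_eq_iff)
  then have "V ** (T ** diag_matrix (\<lambda>i. f (d i))) ** conj_transpose U
      = V ** (diag_matrix (\<lambda>i. f (e i)) ** T) ** conj_transpose U"
    by simp
  moreover have "V ** (T ** D) ** conj_transpose U = U ** D ** conj_transpose U" for D
    by (metis T_def VV(2) matrix_mul_assoc matrix_mul_lid)
  moreover have "V ** (D ** T) ** conj_transpose U = V ** D ** conj_transpose V" for D
    by (metis T_def UU(2) matrix_mul_assoc matrix_mul_rid)
  ultimately show ?thesis
    by (simp add: unitary_conj_def)
qed

lemma mat_powr_unitary_conj: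
  assumes "unitary_matrix U" and "\<And>i. 0 \<le> d i"
  shows "mat_powr (unitary_conj U d) a = unitary_conj U (\<lambda>i. d i powr a)"
  unfolding mat_powr_def unitary_conj_def[symmetric]
proof (rule the_equality)
  fix B assume "\<exists>V e. unitary_matrix V \<and> (\<forall>i. 0 \<le> e i) \<and> unitary_conj U d = unitary_conj V e
    \<and> B = unitary_conj V (\<lambda>i. e i powr a)"
  then show "B = unitary_conj U (\<lambda>i. d i powr a)"
    using unitary_conj_cong[OF assms(1), where f = "\<lambda>t. t powr a"] by metis
qed (use assms in blast)

lemma unitary_conj_mult_column:
  assumes "unitary_matrix U"
  shows "unitary_conj U d *v (U *v axis i 1) = complex_of_real (d i) *s (U *v axis i 1)"
proof -
  have "unitary_conj U d *v (U *v axis i 1)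
      = U *v (diag_matrix d *v ((conj_transpose U ** U) *v axis i 1))"
    by (simp add: unitary_conj_def matrix_vector_mul_assoc matrix_mul_assoc)
  also have "diag_matrix d *v ((conj_transpose U ** U) *v axis i 1) = complex_of_real (d i) *s axis i 1"
    using assms unfolding unitary_matrix_def
    by (simp only: matrix_vector_mul_lid) (simp add: vec_eq_iff diag_matrix_mult_vec axis_def)
  finally show ?thesis
    by (simp add: vector_scalar_commute)
qed

lemma norm_unitary_column: "unitary_matrix U \<Longrightarrow> norm (U *v axis i (1::complex)) = 1"
  by (simp add: norm_unitary_mult unitary_matrix_def)

lemma nonneg_definite_hermitian: "nonneg_definite A \<Longrightarrow> conj_transpose A = A"
  by (intro hermitian_if_form_real) (simp add: nonneg_definite_def)

lemma pos_definite_hermitian: "pos_definite A \<Longrightarrow> conj_transpose A = A"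
  by (intro hermitian_if_form_real) (metis Reals_0 cinner_vec_zero(2) pos_definite_def)

text \<open>One \<open>U\<close> and one \<open>d\<close> serve all exponents at once, which makes
  products of different powers computable.\<close>

lemma nonneg_definite_cases:
  assumes "nonneg_definite A"
  obtains U d where "unitary_matrix U" "\<And>i. 0 \<le> d i" "A = unitary_conj U d"
    "\<And>a. mat_powr A a = unitary_conj U (\<lambda>i. d i powr a)"
proof -
  obtain U d where U: "unitary_matrix U" and A: "A = unitary_conj U d"
    using spectral_theorem[OF nonneg_definite_hermitian[OF assms]]
    unfolding unitary_conj_def[symmetric] by blast
  \<comment> \<open>The eigenvalue is the value of the form at the corresponding unit column of
    \<open>U\<close>.\<close>
  have "0 \<le> d i" for i
  proof -
    have "cinner_vec (A *v (U *v axis i 1)) (U *v axis i 1) = complex_of_real (d i)"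
      unfolding A unitary_conj_mult_column[OF U]
      by (simp add: cinner_vec_scale_left cinner_vec_self norm_unitary_column[OF U])
    then show ?thesis
      using assms by (metis Re_complex_of_real nonneg_definite_def)
  qed
  then show thesis
    using that[OF U _ A] mat_powr_unitary_conj[OF U] A by blast
qed

lemma conj_transpose_mat_powr: "nonneg_definite A \<Longrightarrow> conj_transpose (mat_powr A a) = mat_powr A a"
  by (metis conj_transpose_unitary_conj nonneg_definite_cases)

lemma mat_powr_mult_minus:
  assumes "nonneg_definite A" and "invertible A"
  shows "mat_powr A a ** mat_powr A (- a) = mat 1"
proof -
  obtain U d where U: "unitary_matrix U" "\<And>i. 0 \<le> d i" and A: "A = unitary_conj U d"
    "\<And>a. mat_powr A a = unitary_conj U (\<lambda>i. d i powr a)"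
    using nonneg_definite_cases[OF assms(1)] by metis
  \<comment> \<open>A zero eigenvalue must be excluded because
    \<open>0 powr a * 0 powr (- a)\<close> is 0 rather than 1.\<close>
  have "d i \<noteq> 0" for i
  proof
    assume "d i = 0"
    then have "A *v (U *v axis i 1) = 0"
      unfolding A unitary_conj_mult_column[OF U(1)] by (simp add: vec_eq_iff)
    then have "U *v axis i 1 = 0"
      by (metis assms(2) invertible_def matrix_vector_mul_assoc matrix_vector_mul_lid
          matrix_vector_mult_0_right)
    then show False
      using norm_unitary_column[OF U(1), of i] by simp
  qed
  then have "d i powr a * d i powr (- a) = 1" for i
    by (simp add: powr_add[symmetric])
  then show ?thesis
    by (simp add: A(2) unitary_conj_mult U unitary_conj_1)
qed

text \<open>Unitary factors preserve lengths, so only the diagonal matters; each \<open>d i\<close>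
  is the length of \<open>A\<close> applied to a unit vector, and \<open>t powr a\<close> is
  increasing for positive \<open>a\<close>.\<close>

lemma opnorm_mat_powr_le:
  assumes A: "nonneg_definite A" and a: "0 < a"
  shows "opnorm (mat_powr A a) \<le> opnorm A powr a"
proof -
  obtain U d where U: "unitary_matrix U" "\<And>i. 0 \<le> d i" and A: "A = unitary_conj U d"
    "\<And>a. mat_powr A a = unitary_conj U (\<lambda>i. d i powr a)"
    using nonneg_definite_cases[OF assms(1)] by metis
  have UU: "conj_transpose U ** U = mat 1"
      "conj_transpose (conj_transpose U) ** conj_transpose U = mat 1"
    using U(1) by (auto simp: unitary_matrix_def)
  have d: "d i powr a \<le> opnorm A powr a" for i
  proof -
    have "d i \<le> norm (A *v (U *v axis i 1))"
      unfolding A unitary_conj_mult_column[OF U(1)]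
      by (simp add: norm_smult_complex norm_unitary_column[OF U(1)])
    also have "\<dots> \<le> opnorm A"
      using norm_le_opnorm[of A "U *v axis i 1"] by (simp add: norm_unitary_column[OF U(1)])
    finally show ?thesis
      using a U(2) by (intro powr_mono2) auto
  qed
  show ?thesis
  proof (rule opnorm_bound)
    fix z
    let ?y = "conj_transpose U *v z"
    have "norm (mat_powr A a *v z) = norm (diag_matrix (\<lambda>i. d i powr a) *v ?y)"
      unfolding A(2) unitary_conj_def matrix_vector_mul_assoc[symmetric] norm_unitary_mult[OF UU(1)] ..
    also have "\<dots> \<le> L2_set (\<lambda>i. opnorm A powr a * norm (?y $ i)) UNIV"
      unfolding norm_vec_def
      by (intro L2_set_mono) (simp_all add: diag_matrix_mult_vec norm_mult mult_right_mono d)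
    also have "\<dots> = opnorm A powr a * norm ?y"
      by (simp add: norm_vec_def L2_set_right_distrib)
    finally show "norm (mat_powr A a *v z) \<le> opnorm A powr a * norm z"
      using norm_unitary_mult[OF UU(2)] by simp
  qed
qed

subsection \<open>Measurability of matrix powers\<close>

lemma continuous_on_matrix_mult:
  fixes f g :: "'a::topological_space \<Rightarrow> complex^'m^'m"
  assumes "continuous_on S f" "continuous_on S g"
  shows "continuous_on S (\<lambda>x. f x ** g x)"
  unfolding matrix_matrix_mult_def using assms
  by (intro continuous_intros)

lemma borel_measurable_matrix_mult:
  fixes f g :: "'a \<Rightarrow> complex^'m^'m"
  assumes "f \<in> borel_measurable M" "g \<in> borel_measurable M"
  shows "(\<lambda>x. f x ** g x) \<in> borel_measurable M"
  using assms
  by (rule borel_measurable_continuous_Pair) (intro continuous_on_matrix_mult continuous_intros)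

lemma borel_measurable_opnorm:
  "f \<in> borel_measurable M \<Longrightarrow> (\<lambda>x. opnorm (f x)) \<in> borel_measurable M"
  by (rule borel_measurable_continuous_on[OF continuous_on_opnorm])

lemma borel_measurable_norm_matrix_vector_mult:
  fixes f :: "'a \<Rightarrow> complex^'m^'m"
  assumes "f \<in> borel_measurable M"
  shows "(\<lambda>x. norm (f x *v z)) \<in> borel_measurable M"
proof (rule borel_measurable_continuous_on[OF _ assms])
  show "continuous_on UNIV (\<lambda>A::complex^'m^'m. norm (A *v z))"
    unfolding matrix_vector_mult_def by (intro continuous_intros)
qed

text \<open>Sums and products of functions of \<open>d\<close> correspond to sums and products of
  matrices with the same \<open>U\<close>. The resulting \<open>G\<close> is given by a formula in
  the matrix alone, hence is continuous without reference to eigenvectors.\<close>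

lemma polynomial_matrix_calculus:
  assumes "real_polynomial_function g"
  shows "\<exists>G :: complex^'m^'m \<Rightarrow> complex^'m^'m. continuous_on UNIV G \<and>
    (\<forall>U d. unitary_matrix U \<longrightarrow> G (unitary_conj U d) = unitary_conj U (\<lambda>i. g (d i)))"
  using assms
proof (induction rule: real_polynomial_function.induct)
  case (linear f)
  obtain c where f: "f t = c * t" for t
    using linear_scale[of f _ 1] bounded_linear.linear[OF linear]
    by (metis mult.commute mult.right_neutral real_scaleR_def)
  have "c *\<^sub>R unitary_conj U d = unitary_conj U (\<lambda>i. f (d i))" for U :: "complex^'m^'m" and d
    unfolding vec_eq_iff vector_scaleR_component unitary_conj_component scaleR_sum_right f
    by (auto intro!: sum.cong simp: scaleR_conv_of_real[where 'a=complex])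
  then show ?case
    by (intro exI[of _ "\<lambda>A. c *\<^sub>R A"]) (auto intro!: continuous_intros)
next
  case (const c)
  have "c *\<^sub>R (mat 1) = unitary_conj U (\<lambda>i. c)" if "unitary_matrix U" for U :: "complex^'m^'m"
    unfolding unitary_conj_1[OF that, symmetric]
    unfolding vec_eq_iff vector_scaleR_component unitary_conj_component scaleR_sum_right
    by (auto intro!: sum.cong simp: scaleR_conv_of_real[where 'a=complex])
  then show ?case
    by (intro exI[of _ "\<lambda>A. c *\<^sub>R mat 1"]) (auto intro!: continuous_intros)
next
  case (add f g)
  then obtain F G :: "complex^'m^'m \<Rightarrow> complex^'m^'m" where
    "continuous_on UNIV F" "continuous_on UNIV G"
    "\<And>U d. unitary_matrix U \<Longrightarrow> F (unitary_conj U d) = unitary_conj U (\<lambda>i. f (d i))"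
    "\<And>U d. unitary_matrix U \<Longrightarrow> G (unitary_conj U d) = unitary_conj U (\<lambda>i. g (d i))"
    by blast
  moreover have "unitary_conj U d + unitary_conj U e = unitary_conj U (\<lambda>i. d i + e i)"
    for U :: "complex^'m^'m" and d e
    by (simp add: vec_eq_iff unitary_conj_component sum.distrib algebra_simps)
  ultimately show ?case
    by (intro exI[of _ "\<lambda>A. F A + G A"]) (auto intro!: continuous_intros)
next
  case (mult f g)
  then obtain F G :: "complex^'m^'m \<Rightarrow> complex^'m^'m" where
    "continuous_on UNIV F" "continuous_on UNIV G"
    "\<And>U d. unitary_matrix U \<Longrightarrow> F (unitary_conj U d) = unitary_conj U (\<lambda>i. f (d i))"
    "\<And>U d. unitary_matrix U \<Longrightarrow> G (unitary_conj U d) = unitary_conj U (\<lambda>i. g (d i))"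
    by blast
  then show ?case
    by (intro exI[of _ "\<lambda>A. F A ** G A"]) (auto intro!: continuous_on_matrix_mult simp: unitary_conj_mult)
qed

text \<open>Pointwise convergence is enough, since the spectrum of a matrix is finite; this is what
  makes the discontinuity of \<open>t powr a\<close> at \<open>0\<close> for \<open>a \<le> 0\<close> harmless.\<close>

lemma polynomials_tendsto_powr:
  obtains g :: "nat \<Rightarrow> real \<Rightarrow> real" where "\<And>k. real_polynomial_function (g k)"
    "\<And>t. 0 \<le> t \<Longrightarrow> (\<lambda>k. g k t) \<longlonglongrightarrow> t powr a"
proof -
  \<comment> \<open>A continuous substitute for \<open>t powr a\<close>: the second factor keeps the
    base away from 0, so negative exponents do no harm, and the cutoff
    \<open>min (real k * t) 1\<close> restores the value 0 at \<open>t = 0\<close>. For each fixed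
    \<open>t\<close> the substitute is exact once \<open>k\<close> is large.\<close>
  define f where "f k t = min (real k * t) 1 * max t (1 / (real k + 1)) powr a" for k t
  \<comment> \<open>Growing intervals and shrinking errors together give pointwise convergence on
    the whole half-line.\<close>
  have "\<exists>g. real_polynomial_function g \<and> (\<forall>t\<in>{0..real k}. \<bar>f k t - g t\<bar> < 1 / (real k + 1))" for k
  proof -
    have pos: "max t (1 / (real k + 1)) \<noteq> 0" for t
      by (metis add_nonneg_pos less_max_iff_disj of_nat_0_le_iff order_less_irrefl zero_less_divide_1_iff zero_less_one)
    have "continuous_on {0..real k} (f k)"
      unfolding f_def using pos by (intro continuous_intros) auto
    then show ?thesis
      using Stone_Weierstrass_real_polynomial_function[of "{0..real k}" "f k" "1 / (real k + 1)"]
      by (metis compact_Icc add_nonneg_pos of_nat_0_le_iff zero_less_divide_1_iff zero_less_one)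
  qed
  then obtain g where g: "\<And>k. real_polynomial_function (g k)"
    "\<And>k t. t \<in> {0..real k} \<Longrightarrow> \<bar>f k t - g k t\<bar> < 1 / (real k + 1)"
    by metis
  have "(\<lambda>k. g k t) \<longlonglongrightarrow> t powr a" if t: "0 \<le> t" for t
  proof -
    have "\<forall>\<^sub>F k in sequentially. t \<le> real k \<and> 1 / t \<le> real k"
      by (intro eventually_conj eventually_sequentiallyI[of "nat \<lceil>t\<rceil>"]
          eventually_sequentiallyI[of "nat \<lceil>1 / t\<rceil>"]) linarith+
    then have "\<forall>\<^sub>F k in sequentially. norm (g k t - t powr a) \<le> 1 / (real k + 1)"
    proof eventually_elim
      case (elim k)
      have "f k t = t powr a"
      proof (cases "t = 0")
        case False
        then have "1 \<le> real k * t"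
          using elim t by (simp add: field_simps)
        then have "1 \<le> (real k + 1) * t"
          using t by (simp add: algebra_simps)
        then have "1 / (real k + 1) \<le> t"
          by (simp add: field_simps add_pos_nonneg)
        with \<open>1 \<le> real k * t\<close> show ?thesis
          by (simp add: f_def)
      qed (simp add: f_def)
      then show ?case
        using g(2)[of t k] elim t by auto
    qed
    then have "(\<lambda>k. g k t - t powr a) \<longlonglongrightarrow> 0"
      by (rule Lim_null_comparison)
        (simp add: LIMSEQ_inverse_real_of_nat[unfolded inverse_eq_divide of_nat_Suc] add.commute)
    then show ?thesis
      by (simp add: LIM_zero_iff)
  qed
  with g(1) show thesis
    by (rule that)
qed

text \<open>The approximants \<open>G k (F x)\<close> are continuous in \<open>F x\<close>. A
  diagonalization is used only at one fixed \<open>x\<close>, to identify the limit, so its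
  dependence on \<open>x\<close> is irrelevant.\<close>

lemma borel_measurable_mat_powr:
  fixes F :: "'a \<Rightarrow> complex^'m^'m"
  assumes F: "F \<in> borel_measurable M" and nonneg: "\<And>x. nonneg_definite (F x)"
  shows "(\<lambda>x. mat_powr (F x) a) \<in> borel_measurable M"
proof -
  obtain g where g: "\<And>k::nat. real_polynomial_function (g k)"
    "\<And>t. 0 \<le> t \<Longrightarrow> (\<lambda>k. g k t) \<longlonglongrightarrow> t powr a"
    using polynomials_tendsto_powr by metis
  obtain G :: "nat \<Rightarrow> complex^'m^'m \<Rightarrow> complex^'m^'m" where G: "\<And>k. continuous_on UNIV (G k)"
    "\<And>k U d. unitary_matrix U \<Longrightarrow> G k (unitary_conj U d) = unitary_conj U (\<lambda>i. g k (d i))"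
    using polynomial_matrix_calculus[OF g(1)] by metis
  show ?thesis
  proof (rule borel_measurable_LIMSEQ_metric)
    show "(\<lambda>x. G k (F x)) \<in> borel_measurable M" for k
      by (rule borel_measurable_continuous_on[OF G(1) F])
    show "(\<lambda>k. G k (F x)) \<longlonglongrightarrow> mat_powr (F x) a" for x
    proof -
      obtain U d where U: "unitary_matrix U" "\<And>i. 0 \<le> d i" "F x = unitary_conj U d"
        "\<And>a. mat_powr (F x) a = unitary_conj U (\<lambda>i. d i powr a)"
        using nonneg_definite_cases[OF nonneg[of x]] by metis
      show ?thesis
        unfolding U(4) unfolding U(3) G(2)[OF U(1)]
        by (intro vec_tendstoI) (auto simp: unitary_conj_component intro!: tendsto_intros g(2) U(2))
    qed
  qed
qed

subsection \<open>Averages\<close>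

text \<open>Integrability belongs to the predicate because the Bochner integral of a nonintegrable
  function is 0, which would make the bound meaningless.\<close>

definition average_le :: "(real^'n) set \<Rightarrow> (real^'n \<Rightarrow> real) \<Rightarrow> real \<Rightarrow> bool" where
  "average_le Q f K \<longleftrightarrow> set_integrable lebesgue Q f \<and> average Q f \<le> K"

lemma average_mono:
  assumes "set_integrable lebesgue Q f" "set_integrable lebesgue Q g"
    and "AE x\<in>Q in lebesgue. f x \<le> g x"
  shows "average Q f \<le> average Q g"
  unfolding average_def using assms
  by (intro divide_right_mono set_integral_mono_AE) auto

lemma average_cmult: "average Q (\<lambda>x. c * f x) = c * average Q f"
  by (simp add: average_def)

lemma average_sum:
  assumes "\<And>i. i \<in> I \<Longrightarrow> set_integrable lebesgue Q (f i)"
  shows "average Q (\<lambda>x. \<Sum>i\<in>I. f i x) = (\<Sum>i\<in>I. average Q (f i))"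
    and "set_integrable lebesgue Q (\<lambda>x. \<Sum>i\<in>I. f i x)"
  using assms unfolding average_def set_lebesgue_integral_def set_integrable_def scaleR_sum_right
  by (simp_all only: Bochner_Integration.integral_sum Bochner_Integration.integrable_sum
      sum_divide_distrib)

lemma average_le_add:
  "average_le Q f K \<Longrightarrow> average_le Q g L \<Longrightarrow> average_le Q (\<lambda>x. f x + g x) (K + L)"
  by (auto simp: average_le_def average_def add_divide_distrib)

lemma average_le_cmult:
  "average_le Q f K \<Longrightarrow> 0 \<le> c \<Longrightarrow> average_le Q (\<lambda>x. c * f x) (c * K)"
  by (auto simp: average_le_def average_cmult mult_left_mono)

lemma average_le_sum:
  assumes "\<And>i. i \<in> I \<Longrightarrow> average_le Q (f i) (K i)"
  shows "average_le Q (\<lambda>x. \<Sum>i\<in>I. f i x) (\<Sum>i\<in>I. K i)"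
  using assms unfolding average_le_def by (simp add: average_sum sum_mono)

text \<open>The minorant contributes integrability only; the bound \<open>K\<close> is inherited
  from \<open>g\<close>.\<close>

lemma average_le_sandwich:
  assumes "h \<in> borel_measurable lebesgue" and Q: "Q \<in> sets lebesgue"
    and "AE x\<in>Q in lebesgue. - l x \<le> h x \<and> h x \<le> g x"
    and l: "set_integrable lebesgue Q l" and g: "average_le Q g K"
  shows "average_le Q h K"
proof -
  have gi: "set_integrable lebesgue Q g"
    using g by (simp add: average_le_def)
  have "set_integrable lebesgue Q (\<lambda>x. \<bar>l x\<bar> + \<bar>g x\<bar>)"
    using l gi by (intro set_integral_add set_integrable_abs)
  then have hi: "set_integrable lebesgue Q h"
  proof (rule set_integrable_bound)
    show "set_borel_measurable lebesgue Q h"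
      using assms(1) Q by (simp add: set_borel_measurable_def)
    show "AE x in lebesgue. x \<in> Q \<longrightarrow> norm (h x) \<le> norm (\<bar>l x\<bar> + \<bar>g x\<bar>)"
      using assms(3) by eventually_elim auto
  qed
  moreover have "average Q h \<le> average Q g"
    using assms(3) by (intro average_mono hi gi) auto
  ultimately show ?thesis
    using g by (auto simp: average_le_def)
qed

lemma average_le_const:
  assumes "Q \<in> sets lebesgue" "0 < measure lebesgue Q"
  shows "average_le Q (\<lambda>_. c) c"
proof -
  have "emeasure lebesgue Q < \<infinity>"
    using assms(2) by (metis enn2real_top infinity_ennreal_def less_irrefl measure_def top.not_eq_extremum)
  then have "set_integrable lebesgue Q (\<lambda>_. c)" "(LINT x:Q|lebesgue. c) = measure lebesgue Q * c"
    using assms(1) by (auto simp: set_integrable_def set_lebesgue_integral_def)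
  then show ?thesis
    using assms(2) by (simp add: average_le_def average_def)
qed

text \<open>\<open>ennreal\<close> sends negative numbers to 0, so the right-hand side is the
  integral of the positive part.\<close>

lemma set_integrable_max_0:
  assumes "g \<in> borel_measurable lebesgue" "Q \<in> sets lebesgue"
  shows "set_integrable lebesgue Q (\<lambda>x. max 0 (g x))
    \<longleftrightarrow> (\<integral>\<^sup>+x\<in>Q. ennreal (g x) \<partial>lebesgue) < \<infinity>"
proof -
  have "(\<integral>\<^sup>+x. ennreal (indicator Q x *\<^sub>R max 0 (g x)) \<partial>lebesgue)
      = (\<integral>\<^sup>+x\<in>Q. ennreal (g x) \<partial>lebesgue)"
    by (intro nn_integral_cong) (auto simp: indicator_def max_def ennreal_neg)
  then show ?thesis
    using assms by (simp add: set_integrable_def integrable_iff_bounded indicator_def flip: indicator_def)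
qed

lemma nn_integral_max_0:
  assumes "set_integrable lebesgue Q (\<lambda>x. max 0 (g x))"
  shows "(\<integral>\<^sup>+x\<in>Q. ennreal (g x) \<partial>lebesgue) = ennreal (LINT x:Q|lebesgue. max 0 (g x))"
proof -
  have "(\<integral>\<^sup>+x\<in>Q. ennreal (g x) \<partial>lebesgue)
      = (\<integral>\<^sup>+x. ennreal (indicator Q x *\<^sub>R max 0 (g x)) \<partial>lebesgue)"
    by (intro nn_integral_cong) (auto simp: indicator_def max_def ennreal_neg)
  also have "\<dots> = ennreal (LINT x:Q|lebesgue. max 0 (g x))"
    using assms unfolding set_integrable_def set_lebesgue_integral_def
    by (intro nn_integral_eq_integral) auto
  finally show ?thesis .
qed

text \<open>The bridge between extended and ordinary averages. With an integrable negative part, the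
  extended average is either \<open>\<infinity>\<close> or the Bochner average, and it is finite
  precisely when \<open>g\<close> is integrable.\<close>

lemma ext_exp_ext_average_le_iff:
  fixes f :: "real^'n \<Rightarrow> ereal" and g :: "real^'n \<Rightarrow> real"
  assumes Q: "Q \<in> sets lebesgue" "0 < measure lebesgue Q"
    and g: "g \<in> borel_measurable lebesgue"
    and eq: "AE x\<in>Q in lebesgue. f x = ereal (g x)"
    and neg: "set_integrable lebesgue Q (\<lambda>x. max 0 (- g x))"
    and C: "0 < C"
  shows "ext_exp (ext_average Q f) \<le> ereal C \<longleftrightarrow> average_le Q g (ln C)"
proof -
  have P: "(\<integral>\<^sup>+x\<in>Q. e2ennreal (f x) \<partial>lebesgue) = (\<integral>\<^sup>+x\<in>Q. ennreal (g x) \<partial>lebesgue)"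
    using eq by (intro nn_integral_cong_AE, eventually_elim) (auto simp: indicator_def ennreal.abs_eq e2ennreal_ereal)
  have "(\<integral>\<^sup>+x\<in>Q. e2ennreal (- f x) \<partial>lebesgue) = (\<integral>\<^sup>+x\<in>Q. ennreal (- g x) \<partial>lebesgue)"
    using eq by (intro nn_integral_cong_AE, eventually_elim) (auto simp: indicator_def)
  also have "\<dots> = ennreal (LINT x:Q|lebesgue. max 0 (- g x))"
    by (rule nn_integral_max_0[OF neg])
  finally have N: "(\<integral>\<^sup>+x\<in>Q. e2ennreal (- f x) \<partial>lebesgue) = ennreal (LINT x:Q|lebesgue. max 0 (- g x))" .
  have nonneg: "0 \<le> (LINT x:Q|lebesgue. max 0 (h x))" for h :: "real^'n \<Rightarrow> real"
    unfolding set_lebesgue_integral_def by (intro integral_nonneg_AE) auto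
  have avg: "ext_average Q f = (enn2ereal (\<integral>\<^sup>+x\<in>Q. ennreal (g x) \<partial>lebesgue)
      - ereal (LINT x:Q|lebesgue. max 0 (- g x))) / ereal (measure lebesgue Q)"
    using nonneg[of "\<lambda>x. - g x"] by (simp add: ext_average_def P N)
  show ?thesis
  proof (cases "set_integrable lebesgue Q (\<lambda>x. max 0 (g x))")
    case True
    have split: "g x = max 0 (g x) - max 0 (- g x)" for x
      by auto
    have int: "set_integrable lebesgue Q g"
      and "(LINT x:Q|lebesgue. g x)
        = (LINT x:Q|lebesgue. max 0 (g x)) - (LINT x:Q|lebesgue. max 0 (- g x))"
      using set_integral_diff[OF True neg] unfolding split[symmetric] by simp_all
    then have "ext_average Q f = ereal (average Q g)"
      using nonneg[of g] Q(2) unfolding avg nn_integral_max_0[OF True]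
      by (simp add: average_def)
    then show ?thesis
      using C int by (simp add: ext_exp_def average_le_def ln_ge_iff)
  next
    \<comment> \<open>Here both sides fail: the extended average is \<open>\<infinity>\<close>, and
      \<open>g\<close> is not integrable.\<close>
    case False
    then have "(\<integral>\<^sup>+x\<in>Q. ennreal (g x) \<partial>lebesgue) = \<infinity>"
      using set_integrable_max_0[OF g Q(1)] by (metis infinity_ennreal_def top.not_eq_extremum)
    then have "ext_average Q f = \<infinity>"
      using Q(2) by (simp add: avg)
    moreover have "\<not> set_integrable lebesgue Q g"
    proof
      assume int: "set_integrable lebesgue Q g"
      have "set_integrable lebesgue Q (\<lambda>x. (g x + \<bar>g x\<bar>) / 2)"
        by (intro set_integrable_divide set_integral_add int set_integrable_abs)
      moreover have "(\<lambda>x. (g x + \<bar>g x\<bar>) / 2) = (\<lambda>x. max 0 (g x))"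
        by auto
      ultimately show False
        using False by simp
    qed
    ultimately show ?thesis
      by (simp add: ext_exp_def average_le_def)
  qed
qed

subsection \<open>Averages of logarithms\<close>

lemma log_plus_nonneg: "0 \<le> log_plus t"
  by (simp add: log_plus_def)

lemma ln_le_log_plus: "ln t \<le> log_plus t"
  by (simp add: log_plus_def)

lemma log_plus_mono: "0 \<le> s \<Longrightarrow> s \<le> t \<Longrightarrow> log_plus s \<le> log_plus t"
  by (cases "s = 0") (auto simp: log_plus_def max_def)

lemma log_plus_mult: "0 \<le> s \<Longrightarrow> 0 \<le> t \<Longrightarrow> log_plus (s * t) \<le> log_plus s + log_plus t"
  by (cases "s = 0 \<or> t = 0") (use ln_mult_pos[of s t] in \<open>auto simp: log_plus_def\<close>)

lemma log_plus_powr: "0 \<le> t \<Longrightarrow> 0 < p \<Longrightarrow> log_plus (t powr p) = p * log_plus t"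
  by (cases "t = 0") (auto simp: log_plus_def max_def ln_powr mult_le_0_iff zero_le_mult_iff)

text \<open>This is \<open>ln s \<le> s - 1\<close> at \<open>s = t powr p\<close>.\<close>

lemma log_plus_le_powr:
  assumes "0 \<le> t" "0 < p"
  shows "log_plus t \<le> t powr p / p"
proof (cases "t = 0")
  case False
  then have "p * ln t \<le> t powr p - 1"
    using assms ln_le_minus_one[of "t powr p"] by (simp add: ln_powr)
  then have "ln t \<le> t powr p / p"
    using assms by (simp add: field_simps)
  then show ?thesis
    using assms by (simp add: log_plus_def)
qed (use assms in \<open>simp add: log_plus_def\<close>)

lemma borel_measurable_log_plus:
  "h \<in> borel_measurable M \<Longrightarrow> (\<lambda>x. log_plus (h x)) \<in> borel_measurable M"
  unfolding log_plus_def by (intro borel_measurable_max borel_measurable_const borel_measurable_ln)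

lemma average_le_log_plus_iff:
  assumes "Q \<in> sets lebesgue" "0 < measure lebesgue Q" "h \<in> borel_measurable lebesgue" "0 < C"
  shows "ext_exp (ext_average Q (\<lambda>x. ereal (log_plus (h x)))) \<le> ereal C
    \<longleftrightarrow> average_le Q (\<lambda>x. log_plus (h x)) (ln C)"
  using assms
  by (intro ext_exp_ext_average_le_iff borel_measurable_log_plus)
    (auto simp: max_absorb1 log_plus_nonneg set_integrable_def)

text \<open>The common setting for exchanging \<open>ln\<close> and \<open>log_plus\<close>, applied
  below both to \<open>opnorm (B x ** M)\<close> and to \<open>weight_osc\<close>. Nonnegativity of
  \<open>l\<close> lets it dominate the negative part of \<open>ln (h x)\<close> as well.\<close>

locale log_bounded_below =
  fixes Q :: "(real^'n) set" and h l :: "real^'n \<Rightarrow> real"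
  assumes Q: "Q \<in> sets lebesgue" "0 < measure lebesgue Q"
    and h: "h \<in> borel_measurable lebesgue"
    and pos: "AE x\<in>Q in lebesgue. 0 < h x \<and> - ln (h x) \<le> l x"
    and l: "set_integrable lebesgue Q l" "\<And>x. 0 \<le> l x"
begin

lemma average_le_ln_iff:
  assumes "0 < C"
  shows "ext_exp (ext_average Q (\<lambda>x. ext_log (h x))) \<le> ereal C
    \<longleftrightarrow> average_le Q (\<lambda>x. ln (h x)) (ln C)"
proof (rule ext_exp_ext_average_le_iff[OF Q _ _ _ assms])
  show meas: "(\<lambda>x. ln (h x)) \<in> borel_measurable lebesgue"
    using h by measurable
  show "AE x\<in>Q in lebesgue. ext_log (h x) = ereal (ln (h x))"
    using pos by eventually_elim (auto simp: ext_log_def)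
  show "set_integrable lebesgue Q (\<lambda>x. max 0 (- ln (h x)))"
  proof (rule set_integrable_bound[OF l(1)])
    show "set_borel_measurable lebesgue Q (\<lambda>x. max 0 (- ln (h x)))"
      using meas Q unfolding set_borel_measurable_def by measurable
    show "AE x in lebesgue. x \<in> Q \<longrightarrow> norm (max 0 (- ln (h x))) \<le> norm (l x)"
      using pos by eventually_elim (use l(2) in auto)
  qed
qed

lemma average_le_ln:
  assumes "average_le Q (\<lambda>x. log_plus (h x)) K"
  shows "average_le Q (\<lambda>x. ln (h x)) K"
proof (rule average_le_sandwich[OF _ Q(1) _ l(1) assms])
  show "AE x\<in>Q in lebesgue. - l x \<le> ln (h x) \<and> ln (h x) \<le> log_plus (h x)"
    using pos by eventually_elim (auto simp: ln_le_log_plus)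
qed (use h in measurable)

text \<open>Adding \<open>l\<close> makes \<open>ln (h x)\<close> nonnegative where it was negative,
  so \<open>log_plus (h x) \<le> ln (h x) + l x\<close>. The exchange costs the average of
  \<open>l\<close>, that is, a factor \<open>exp L\<close> in the exponentiated conditions.\<close>

lemma average_le_log_plus:
  assumes "average_le Q (\<lambda>x. ln (h x)) K" "average_le Q l L"
  shows "average_le Q (\<lambda>x. log_plus (h x)) (K + L)"
proof (rule average_le_sandwich[OF _ Q(1) _ l(1) average_le_add[OF assms]])
  show "AE x\<in>Q in lebesgue. - l x \<le> log_plus (h x) \<and> log_plus (h x) \<le> ln (h x) + l x"
    using pos
  proof eventually_elim
    case (elim x)
    then show ?case
      using l(2)[of x] by (auto simp: log_plus_def)
  qed
qed (rule borel_measurable_log_plus[OF h])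

end

subsection \<open>Matrix weights and reducing operators\<close>

text \<open>The countable cover for \<open>lborel\<close> also serves its completion. This is used
  for the measurability of an integral depending on a parameter.\<close>

lemma sigma_finite_lebesgue: "sigma_finite_measure (lebesgue :: 'a::euclidean_space measure)"
proof
  obtain S :: "'a set set" where "countable S" "S \<subseteq> sets lborel" "\<Union>S = space lborel"
    "\<forall>a\<in>S. emeasure lborel a \<noteq> \<infinity>"
    using lborel.sigma_finite_countable by blast
  then show "\<exists>S :: 'a set set. countable S \<and> S \<subseteq> sets lebesgue \<and> \<Union>S = space lebesgue
      \<and> (\<forall>a\<in>S. emeasure lebesgue a \<noteq> \<infinity>)"
    by (intro exI[of _ S]) auto
qed

text \<open>The matrix is the finite sum of its entries placed by the continuous embeddings
  \<open>E i j\<close>, which reduces measurability to entries.\<close>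

lemma borel_measurable_matrix:
  fixes F :: "'a \<Rightarrow> complex^'m^'m"
  assumes "\<And>i j. (\<lambda>x. F x $ i $ j) \<in> borel_measurable M"
  shows "F \<in> borel_measurable M"
proof -
  define E :: "'m \<Rightarrow> 'm \<Rightarrow> complex \<Rightarrow> complex^'m^'m" where
    "E i j c = (\<chi> k l. if k = i then (if l = j then c else 0) else 0)" for i j c
  have cont: "continuous_on UNIV (E i j)" for i j
  proof -
    have "continuous_on UNIV (\<lambda>c::complex. if k = i then (if l = j then c else 0) else 0)" for k l
      by (cases "k = i"; cases "l = j") auto
    then show ?thesis
      unfolding E_def by (intro continuous_on_vec_lambda)
  qed
  have "F x $ k $ l = (\<Sum>i\<in>UNIV. \<Sum>j\<in>UNIV. E i j (F x $ i $ j)) $ k $ l" for x k l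
  proof -
    have "(\<Sum>i\<in>UNIV. \<Sum>j\<in>UNIV. E i j (F x $ i $ j)) $ k $ l
        = (\<Sum>i\<in>UNIV. if k = i then \<Sum>j\<in>UNIV. if l = j then F x $ i $ j else 0 else 0)"
      unfolding sum_component by (intro sum.cong refl) (auto simp: E_def)
    then show ?thesis by simp
  qed
  then have "F = (\<lambda>x. \<Sum>i\<in>UNIV. \<Sum>j\<in>UNIV. E i j (F x $ i $ j))"
    unfolding fun_eq_iff vec_eq_iff by blast
  moreover have "\<dots> \<in> borel_measurable M"
    by (intro borel_measurable_sum borel_measurable_continuous_on[OF cont] assms)
  ultimately show ?thesis by simp
qed

text \<open>Local integrability yields measurability of the truncations to balls; at each point the
  truncations are eventually equal to the entry itself.\<close>

lemma matrix_weight_measurable: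
  fixes W :: "real^'n \<Rightarrow> complex^'m^'m"
  assumes "matrix_weight W"
  shows "W \<in> borel_measurable lebesgue"
proof (rule borel_measurable_matrix)
  fix i j
  show "(\<lambda>x. W x $ i $ j) \<in> borel_measurable lebesgue"
  proof (rule borel_measurable_LIMSEQ_metric)
    fix k :: nat
    have "(\<lambda>x. W x $ i $ j) absolutely_integrable_on cball 0 (real k)"
      using assms by (simp add: matrix_weight_def)
    then show "(\<lambda>x. indicator (cball 0 (real k)) x *\<^sub>R W x $ i $ j) \<in> borel_measurable lebesgue"
      unfolding set_integrable_def by (rule borel_measurable_integrable)
  next
    fix x :: "real^'n"
    have "x \<in> cball 0 (real k)" if "nat \<lceil>norm x\<rceil> \<le> k" for k
      using that real_nat_ceiling_ge[of "norm x"] by (simp add: order_trans)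
    then have "\<forall>\<^sub>F k in sequentially. x \<in> cball 0 (real k)"
      by (rule eventually_sequentiallyI)
    then have "\<forall>\<^sub>F k in sequentially. indicator (cball 0 (real k)) x *\<^sub>R W x $ i $ j = W x $ i $ j"
      by eventually_elim simp
    then show "(\<lambda>k. indicator (cball 0 (real k)) x *\<^sub>R W x $ i $ j) \<longlonglongrightarrow> W x $ i $ j"
      by (rule tendsto_eventually)
  qed
qed

lemma matrix_weight_opnorm_integrable:
  fixes W :: "real^'n \<Rightarrow> complex^'m^'m"
  assumes W: "matrix_weight W" and Q: "bounded Q" "Q \<in> sets lebesgue"
  shows "set_integrable lebesgue Q (\<lambda>x. opnorm (W x))"
proof (rule set_integrable_bound)
  obtain r where r: "Q \<subseteq> cball 0 r"
    using bounded_subset_ballD[OF Q(1), of 0] ball_subset_cball by (metis subset_trans)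
  have "(\<lambda>x. W x $ i $ j) absolutely_integrable_on cball 0 r" for i j
    using W unfolding matrix_weight_def by (metis compact_cball)
  then have "(\<lambda>x. W x $ i $ j) absolutely_integrable_on Q" for i j
    by (rule set_integrable_subset[OF _ Q(2) r])
  then have "set_integrable lebesgue Q (\<lambda>x. norm (W x $ i $ j))" for i j
    by (rule set_integrable_norm)
  then show "set_integrable lebesgue Q (\<lambda>x. \<Sum>i\<in>UNIV. \<Sum>j\<in>UNIV. norm (W x $ i $ j))"
    by (rule average_sum(2)[OF average_sum(2)])
  show "set_borel_measurable lebesgue Q (\<lambda>x. opnorm (W x))"
    using borel_measurable_opnorm[OF matrix_weight_measurable[OF W]] Q(2)
    by (simp add: set_borel_measurable_def)
  have "opnorm (W x) \<le> (\<Sum>i\<in>UNIV. \<Sum>j\<in>UNIV. norm (W x $ i $ j))" for x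
  proof -
    have "norm (W x) \<le> (\<Sum>i\<in>UNIV. norm (W x $ i))"
      unfolding norm_vec_def[of "W x"] by (rule L2_set_le_sum) simp
    also have "\<dots> \<le> (\<Sum>i\<in>UNIV. \<Sum>j\<in>UNIV. norm (W x $ i $ j))"
      proof (rule sum_mono)
      show "norm (W x $ i) \<le> (\<Sum>j\<in>UNIV. norm (W x $ i $ j))" for i
        unfolding norm_vec_def[of "W x $ i"] by (rule L2_set_le_sum) simp
    qed
    finally show ?thesis
      using opnorm_le_norm[of "W x"] by simp
  qed
  then show "AE x in lebesgue. x \<in> Q \<longrightarrow>
      norm (opnorm (W x)) \<le> norm (\<Sum>i\<in>UNIV. \<Sum>j\<in>UNIV. norm (W x $ i $ j))"
    by (simp add: sum_nonneg opnorm_nonneg)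
qed

section \<open>Comparing a matrix with its columns\<close>

lemma sum_le_card_mult:
  fixes a :: "'m::finite \<Rightarrow> real"
  obtains k where "(\<Sum>j\<in>UNIV. a j) \<le> real CARD('m) * a k"
proof -
  have "Max (range a) \<in> range a"
    by (intro Max_in) auto
  then obtain k where "a k = Max (range a)"
    by (metis imageE)
  then have "(\<Sum>j\<in>UNIV. a j) \<le> real CARD('m) * a k"
    using sum_bounded_above[of UNIV a "a k"] by simp
  then show thesis
    by (rule that)
qed

text \<open>Passing to the largest column before taking powers treats \<open>p < 1\<close> and
  \<open>p \<ge> 1\<close> alike, at the price of the factor
  \<open>real CARD('m) powr p\<close>.\<close>

lemma opnorm_powr_le_sum_columns:
  fixes M :: "complex^'m^'m"
  assumes p: "0 < p"
  shows "opnorm M powr p \<le> real CARD('m) powr p * (\<Sum>j\<in>UNIV. norm (M *v axis j 1) powr p)"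
proof -
  obtain k where "(\<Sum>j\<in>UNIV. norm (M *v axis j 1)) \<le> real CARD('m) * norm (M *v axis k 1)"
    using sum_le_card_mult by blast
  then have "opnorm M powr p \<le> (real CARD('m) * norm (M *v axis k 1)) powr p"
    using opnorm_le_sum_columns[of M] p by (intro powr_mono2 opnorm_nonneg) auto
  also have "\<dots> = real CARD('m) powr p * norm (M *v axis k 1) powr p"
    by (simp add: powr_mult)
  also have "\<dots> \<le> real CARD('m) powr p * (\<Sum>j\<in>UNIV. norm (M *v axis j 1) powr p)"
    by (intro mult_left_mono member_le_sum) auto
  finally show ?thesis .
qed

lemma log_plus_opnorm_le_sum_columns:
  fixes M :: "complex^'m^'m"
  shows "log_plus (opnorm M) \<le> ln (real CARD('m)) + (\<Sum>j\<in>UNIV. log_plus (norm (M *v axis j 1)))"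
proof -
  obtain k where "(\<Sum>j\<in>UNIV. norm (M *v axis j 1)) \<le> real CARD('m) * norm (M *v axis k 1)"
    using sum_le_card_mult by blast
  then have "log_plus (opnorm M) \<le> log_plus (real CARD('m) * norm (M *v axis k 1))"
    using opnorm_le_sum_columns[of M] by (intro log_plus_mono opnorm_nonneg) auto
  also have "\<dots> \<le> log_plus (real CARD('m)) + log_plus (norm (M *v axis k 1))"
    by (rule log_plus_mult) auto
  also have "log_plus (real CARD('m)) = ln (real CARD('m))"
    by (simp add: log_plus_def)
  also have "log_plus (norm (M *v axis k 1)) \<le> (\<Sum>j\<in>UNIV. log_plus (norm (M *v axis j 1)))"
    by (rule member_le_sum) (auto simp: log_plus_nonneg)
  finally show ?thesis by simp
qed

text \<open>Embeds vectors isometrically into matrices with the operator norm, so that vector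
  conditions become special cases of matrix conditions. \<open>SOME k. True\<close> merely fixes one
  column index.\<close>

definition column_matrix :: "complex^'m \<Rightarrow> complex^'m^'m" where
  "column_matrix z = (\<chi> i j. if j = (SOME k. True) then z $ i else 0)"

lemma matrix_mult_column_matrix: "X ** column_matrix z = column_matrix (X *v z)"
  by (simp add: column_matrix_def matrix_matrix_mult_def matrix_vector_mult_def vec_eq_iff)

lemma opnorm_column_matrix: "opnorm (column_matrix z) = norm z"
proof -
  let ?k = "SOME k. True"
  have *: "column_matrix z *v u = u $ ?k *s z" for u
    unfolding vec_eq_iff
    by (simp add: column_matrix_def matrix_vector_mult_def if_distrib if_distribR cong: if_cong)
  have "cmod (u $ ?k) * norm z \<le> norm z * norm u" for u :: "complex^'a"
    using mult_right_mono[OF Finite_Cartesian_Product.norm_nth_le[of u ?k] norm_ge_zero[of z]]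
    by (simp add: mult.commute)
  then have "opnorm (column_matrix z) \<le> norm z"
    by (intro opnorm_bound) (simp add: * norm_smult_complex)
  moreover have "norm z \<le> opnorm (column_matrix z)"
    using opnorm_ge_column[of "column_matrix z" ?k] by (simp add: * norm_smult_complex)
  ultimately show ?thesis by simp
qed

lemma pos_definite_invertible:
  assumes "pos_definite A"
  shows "invertible A"
proof -
  have "z = 0" if "A *v z = 0" for z
    using assms that unfolding pos_definite_def by (metis cinner_vec_zero(1) order_less_irrefl zero_complex.simps(1))
  then have "inj ((*v) A)"
    by (simp add: linear_injective_0)
  then show ?thesis
    by (metis invertible_left_inverse matrix_left_invertible_injective)
qed

text \<open>All estimates for a single set \<open>Q\<close>. In \<open>K\<close>, the factor
  \<open>real CARD('m) powr p\<close> comes from the column bound and the factor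
  \<open>real CARD('m)\<close> from summing over the columns. Since \<open>K\<close>,
  \<open>c1\<close> and \<open>c2\<close> do not involve \<open>Q\<close>, the resulting bounds are
  uniform over cubes.\<close>

locale reduced_weight =
  fixes p c1 c2 K :: real and W :: "real^'n \<Rightarrow> complex^'m^'m"
    and Q :: "(real^'n) set" and A :: "complex^'m^'m"
  assumes p: "0 < p" and W: "matrix_weight W" and c1: "0 < c1" and c2: "0 < c2"
    and reducing: "reducing_operator c1 c2 p W Q A"
    and K_def: "K = real CARD('m) powr p * real CARD('m)"
begin

abbreviation "R x \<equiv> mat_powr (W x) (1/p)"
abbreviation "B x \<equiv> mat_powr (W x) (-1/p)"
abbreviation "A' \<equiv> matrix_inv A"

definition vec_mean :: "complex^'m \<Rightarrow> real" where
  "vec_mean z = average Q (\<lambda>x. norm (R x *v z) powr p)"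

definition mat_mean :: "complex^'m^'m \<Rightarrow> real" where
  "mat_mean M = average Q (\<lambda>x. opnorm (R x ** M) powr p)"

definition inv_osc :: "real^'n \<Rightarrow> real" where
  "inv_osc x = log_plus (opnorm (R x ** A'))"

lemma K_pos: "0 < K"
  by (simp add: K_def)

lemma Q: "Q \<in> sets lebesgue" "0 < measure lebesgue Q" "bounded Q"
  using reducing by (auto simp: reducing_operator_def)

lemma inverse: "A ** A' = mat 1" "A' ** A = mat 1"
proof -
  have "pos_definite A"
    using reducing by (simp add: reducing_operator_def)
  then have "\<exists>A'. A ** A' = mat 1 \<and> A' ** A = mat 1"
    using pos_definite_invertible invertible_def by blast
  then show "A ** A' = mat 1" "A' ** A = mat 1"
    unfolding matrix_inv_def by (metis (mono_tags, lifting) someI_ex)+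
qed

lemma A_hermitian: "conj_transpose A = A" "conj_transpose A' = A'"
proof -
  show A: "conj_transpose A = A"
    using reducing by (simp add: reducing_operator_def pos_definite_hermitian)
  have "A ** conj_transpose A' = mat 1"
    using arg_cong[OF inverse(2), of conj_transpose] by (simp add: conj_transpose_mult A)
  then show "conj_transpose A' = A'"
    by (metis inverse(2) matrix_mul_assoc matrix_mul_lid matrix_mul_rid)
qed

lemma powers_hermitian: "conj_transpose (R x) = R x" "conj_transpose (B x) = B x"
  using W by (simp_all add: matrix_weight_def conj_transpose_mat_powr)

lemma powers_measurable: "R \<in> borel_measurable lebesgue" "B \<in> borel_measurable lebesgue"
  using W
  by (simp_all add: borel_measurable_mat_powr matrix_weight_measurable[OF W] matrix_weight_def)

lemma opnorm_B_measurable: "(\<lambda>x. opnorm (B x ** M)) \<in> borel_measurable lebesgue"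
  by (intro borel_measurable_opnorm borel_measurable_matrix_mult powers_measurable) simp

lemma opnorm_R_measurable: "(\<lambda>x. opnorm (R x ** M)) \<in> borel_measurable lebesgue"
  by (intro borel_measurable_opnorm borel_measurable_matrix_mult powers_measurable) simp

lemma AE_powers_inverse: "AE x in lebesgue. R x ** B x = mat 1"
proof -
  have "AE x in lebesgue. invertible (W x)"
    using W by (simp add: matrix_weight_def)
  then show ?thesis
  proof eventually_elim
    case (elim x)
    have "nonneg_definite (W x)"
      using W by (simp add: matrix_weight_def)
    then have "R x ** mat_powr (W x) (- (1/p)) = mat 1"
      using elim by (rule mat_powr_mult_minus)
    then show ?case by simp
  qed
qed

lemma opnorm_R_powr_le: "opnorm (R x) powr p \<le> opnorm (W x)"
proof -
  have "opnorm (R x) powr p \<le> (opnorm (W x) powr (1/p)) powr p"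
    using W p by (intro powr_mono2 opnorm_mat_powr_le opnorm_nonneg) (auto simp: matrix_weight_def)
  then show ?thesis
    using p by (simp add: powr_powr opnorm_nonneg)
qed

text \<open>The constant \<open>c\<close> plays the role of \<open>norm z\<close> for vectors and of
  \<open>opnorm M\<close> for matrices; the integrand is dominated through
  \<open>opnorm_R_powr_le\<close>.\<close>

lemma integrable_powr:
  assumes g: "g \<in> borel_measurable lebesgue" "\<And>x. 0 \<le> g x"
    and c: "\<And>x. g x \<le> opnorm (R x) * c" "0 \<le> c"
  shows "set_integrable lebesgue Q (\<lambda>x. g x powr p)"
proof (rule set_integrable_bound)
  show "set_integrable lebesgue Q (\<lambda>x. opnorm (W x) * c powr p)"
    by (intro set_integrable_mult_left matrix_weight_opnorm_integrable W Q)
  have "(\<lambda>x. g x powr p) \<in> borel_measurable lebesgue"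
    using g(1) by measurable
  then show "set_borel_measurable lebesgue Q (\<lambda>x. g x powr p)"
    using Q(1) by (simp add: set_borel_measurable_def)
  have "g x powr p \<le> opnorm (W x) * c powr p" for x
  proof -
    have "g x powr p \<le> (opnorm (R x) * c) powr p"
      using p g(2) c by (intro powr_mono2) auto
    also have "\<dots> = opnorm (R x) powr p * c powr p"
      using c by (simp add: powr_mult opnorm_nonneg)
    also have "\<dots> \<le> opnorm (W x) * c powr p"
      by (intro mult_right_mono opnorm_R_powr_le) simp
    finally show ?thesis .
  qed
  then show "AE x in lebesgue. x \<in> Q \<longrightarrow> norm (g x powr p) \<le> norm (opnorm (W x) * c powr p)"
    by (simp add: opnorm_nonneg)
qed

lemma vec_mean_integrable: "set_integrable lebesgue Q (\<lambda>x. norm (R x *v z) powr p)"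
  by (rule integrable_powr)
    (auto intro: borel_measurable_norm_matrix_vector_mult powers_measurable norm_le_opnorm)

lemma mat_mean_integrable: "set_integrable lebesgue Q (\<lambda>x. opnorm (R x ** M) powr p)"
  by (rule integrable_powr[where c = "opnorm M"])
    (auto intro: opnorm_R_measurable opnorm_mult opnorm_nonneg)

lemma vec_mean_nonneg: "0 \<le> vec_mean z"
  unfolding vec_mean_def average_def set_lebesgue_integral_def
  by (intro divide_nonneg_nonneg integral_nonneg_AE) auto

lemma weight_mean_eq: "weight_mean p W Q z = vec_mean z powr (1/p)"
  by (simp add: weight_mean_def vec_mean_def)

lemma vec_mean_le: "vec_mean z \<le> norm (A *v z) powr p / c1 powr p"
proof -
  have "(c1 * vec_mean z powr (1/p)) powr p \<le> norm (A *v z) powr p"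
    using reducing p c1 by (intro powr_mono2) (auto simp: reducing_operator_def weight_mean_eq)
  then show ?thesis
    using p c1 by (simp add: powr_mult powr_powr vec_mean_nonneg field_simps)
qed

lemma vec_mean_ge: "norm (A *v z) powr p \<le> c2 powr p * vec_mean z"
proof -
  have "norm (A *v z) powr p \<le> (c2 * vec_mean z powr (1/p)) powr p"
    using reducing p by (intro powr_mono2) (auto simp: reducing_operator_def weight_mean_eq)
  then show ?thesis
    using p c2 by (simp add: powr_mult powr_powr vec_mean_nonneg)
qed

text \<open>Each column of \<open>M\<close> is a constant vector, so the reducing property applies
  column by column.\<close>

lemma mat_mean_le: "mat_mean M \<le> K / c1 powr p * opnorm (A ** M) powr p"
proof -
  have "mat_mean M \<le> average Q (\<lambda>x. real CARD('m) powr p *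
      (\<Sum>j\<in>UNIV. norm (R x *v (M *v axis j 1)) powr p))"
    unfolding mat_mean_def
  proof (rule average_mono[OF mat_mean_integrable])
    show "set_integrable lebesgue Q (\<lambda>x. real CARD('m) powr p *
        (\<Sum>j\<in>UNIV. norm (R x *v (M *v axis j 1)) powr p))"
      by (intro set_integrable_mult_right average_sum(2) vec_mean_integrable)
    show "AE x\<in>Q in lebesgue. opnorm (R x ** M) powr p
        \<le> real CARD('m) powr p * (\<Sum>j\<in>UNIV. norm (R x *v (M *v axis j 1)) powr p)"
      using opnorm_powr_le_sum_columns[OF p] by (auto simp: matrix_vector_mul_assoc)
  qed
  also have "\<dots> = real CARD('m) powr p * (\<Sum>j\<in>UNIV. vec_mean (M *v axis j 1))"
    unfolding average_cmult vec_mean_def by (subst average_sum) (auto intro: vec_mean_integrable)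
  also have "\<dots> \<le> real CARD('m) powr p * (\<Sum>j\<in>(UNIV :: 'm set). opnorm (A ** M) powr p / c1 powr p)"
  proof (intro mult_left_mono sum_mono)
    fix j :: 'm
    have "norm (A *v (M *v axis j 1)) powr p \<le> opnorm (A ** M) powr p"
      using p opnorm_ge_column[of "A ** M" j]
      by (intro powr_mono2) (auto simp: matrix_vector_mul_assoc)
    then show "vec_mean (M *v axis j 1) \<le> opnorm (A ** M) powr p / c1 powr p"
      using vec_mean_le[of "M *v axis j 1"] by (meson divide_right_mono order_trans powr_ge_zero)
  qed simp
  also have "\<dots> = K / c1 powr p * opnorm (A ** M) powr p"
    by (simp add: K_def)
  finally show ?thesis .
qed

lemma mat_mean_ge: "opnorm (A ** M) powr p \<le> K * c2 powr p * mat_mean M"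
proof -
  have "vec_mean (M *v axis j 1) \<le> mat_mean M" for j
    unfolding vec_mean_def mat_mean_def
  proof (rule average_mono[OF vec_mean_integrable mat_mean_integrable])
    have "norm (R x *v (M *v axis j 1)) powr p \<le> opnorm (R x ** M) powr p" for x
      using p opnorm_ge_column[of "R x ** M" j]
      by (intro powr_mono2) (auto simp: matrix_vector_mul_assoc)
    then show "AE x\<in>Q in lebesgue.
        norm (R x *v (M *v axis j 1)) powr p \<le> opnorm (R x ** M) powr p"
      by simp
  qed
  then have "norm ((A ** M) *v axis j 1) powr p \<le> c2 powr p * mat_mean M" for j
    using vec_mean_ge[of "M *v axis j 1"]
    by (metis matrix_vector_mul_assoc mult_left_mono order_trans powr_ge_zero)
  then have "(\<Sum>j\<in>UNIV. norm ((A ** M) *v axis j 1) powr p) \<le> (\<Sum>j\<in>(UNIV::'m set). c2 powr p * mat_mean M)"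
    by (intro sum_mono)
  then have "real CARD('m) powr p * (\<Sum>j\<in>UNIV. norm ((A ** M) *v axis j 1) powr p)
      \<le> real CARD('m) powr p * (real CARD('m) * (c2 powr p * mat_mean M))"
    by (intro mult_left_mono) simp_all
  then show ?thesis
    using order_trans[OF opnorm_powr_le_sum_columns[OF p, of "A ** M"]] by (simp add: K_def mult_ac)
qed

lemma inv_osc_nonneg: "0 \<le> inv_osc x"
  by (simp add: inv_osc_def log_plus_nonneg)

text \<open>Here the elementary bound \<open>p log\<^sub>+ t \<le> t powr p\<close> replaces Jensen's inequality.\<close>

lemma average_inv_osc: "average_le Q inv_osc (K / c1 powr p / p)"
proof (rule average_le_sandwich[OF _ Q(1)])
  show "inv_osc \<in> borel_measurable lebesgue"
    unfolding inv_osc_def[abs_def] by (intro borel_measurable_log_plus opnorm_R_measurable)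
  have "log_plus (opnorm (R x ** A')) \<le> 1 / p * opnorm (R x ** A') powr p" for x
    using log_plus_le_powr[OF opnorm_nonneg p] by simp
  then show "AE x\<in>Q in lebesgue. - 0 \<le> inv_osc x \<and> inv_osc x \<le> 1 / p * opnorm (R x ** A') powr p"
    by (simp add: inv_osc_def log_plus_nonneg)
  have "average_le Q (\<lambda>x. opnorm (R x ** A') powr p) (K / c1 powr p)"
    using mat_mean_le[of A'] mat_mean_integrable
    by (simp add: average_le_def mat_mean_def inverse opnorm_mat_1)
  from average_le_cmult[OF this, of "1 / p"]
  show "average_le Q (\<lambda>x. 1 / p * opnorm (R x ** A') powr p) (K / c1 powr p / p)"
    using p by (simp add: mult.commute)
qed (simp add: set_integrable_def)

lemma opnorm_inv_le:
  assumes "R x ** B x = mat 1"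
  shows "opnorm (A' ** M) \<le> opnorm (R x ** A') * opnorm (B x ** M)"
proof -
  have "A' ** M = (A' ** R x) ** (B x ** M)"
    by (metis assms matrix_mul_assoc matrix_mul_rid)
  then have "opnorm (A' ** M) \<le> opnorm (A' ** R x) * opnorm (B x ** M)"
    by (metis opnorm_mult)
  \<comment> \<open>Both factors are Hermitian, so the two products are adjoints of each
    other.\<close>
  moreover have "opnorm (A' ** R x) = opnorm (R x ** A')"
    by (metis A_hermitian(2) conj_transpose_mult opnorm_conj_transpose powers_hermitian(1))
  ultimately show ?thesis by simp
qed

lemma ln_opnorm_lower:
  assumes inv: "R x ** B x = mat 1" and t: "0 < opnorm (A' ** M)"
  shows "0 < opnorm (B x ** M)" "ln (opnorm (A' ** M)) - ln (opnorm (B x ** M)) \<le> inv_osc x"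
proof -
  have le: "opnorm (A' ** M) \<le> opnorm (R x ** A') * opnorm (B x ** M)"
    by (rule opnorm_inv_le[OF inv])
  then have "0 < opnorm (R x ** A') * opnorm (B x ** M)"
    using t by simp
  then have pos: "0 < opnorm (R x ** A')" "0 < opnorm (B x ** M)"
    using opnorm_nonneg[of "R x ** A'"] opnorm_nonneg[of "B x ** M"] by (auto simp: zero_less_mult_iff)
  then show "0 < opnorm (B x ** M)" by simp
  have "ln (opnorm (A' ** M)) \<le> ln (opnorm (R x ** A') * opnorm (B x ** M))"
    using t le by (intro ln_mono) auto
  also have "\<dots> = ln (opnorm (R x ** A')) + ln (opnorm (B x ** M))"
    using pos by (simp add: ln_mult)
  finally show "ln (opnorm (A' ** M)) - ln (opnorm (B x ** M)) \<le> inv_osc x"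
    using ln_le_log_plus[of "opnorm (R x ** A')"] by (simp add: inv_osc_def)
qed

text \<open>The minorant depends on \<open>M\<close> through the logarithm of
  \<open>opnorm (A' ** M)\<close>, taken in absolute value to keep it nonnegative. In general it
  supplies only integrability; it enters a constant only when that norm is 1 and the extra term
  vanishes.\<close>

lemma log_bounded_below_opnorm:
  assumes t: "0 < opnorm (A' ** M)"
  shows "log_bounded_below Q (\<lambda>x. opnorm (B x ** M)) (\<lambda>x. inv_osc x + \<bar>ln (opnorm (A' ** M))\<bar>)"
proof
  show "Q \<in> sets lebesgue" "0 < measure lebesgue Q"
    by (fact Q)+
  show "(\<lambda>x. opnorm (B x ** M)) \<in> borel_measurable lebesgue"
    by (rule opnorm_B_measurable)
  show "AE x\<in>Q in lebesgue. 0 < opnorm (B x ** M) \<and>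
      - ln (opnorm (B x ** M)) \<le> inv_osc x + \<bar>ln (opnorm (A' ** M))\<bar>"
    using AE_powers_inverse
  proof eventually_elim
    case (elim x)
    then show ?case
      using ln_opnorm_lower[OF elim t] by auto
  qed
  show "set_integrable lebesgue Q (\<lambda>x. inv_osc x + \<bar>ln (opnorm (A' ** M))\<bar>)"
    using average_le_add[OF average_inv_osc average_le_const[OF Q(1,2)]] by (simp add: average_le_def)
  show "0 \<le> inv_osc x + \<bar>ln (opnorm (A' ** M))\<bar>" for x
    using inv_osc_nonneg[of x] by simp
qed

text \<open>Covers \<open>M = 0\<close>, where the logarithm is \<open>-\<infinity>\<close>
  everywhere and both sides of (viii) are 0.\<close>

lemma ext_average_MInfty: "ext_exp (ext_average Q (\<lambda>x. - \<infinity>)) = 0"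
proof -
  have "emeasure lebesgue Q \<noteq> 0"
    using Q(2) by (metis emeasure_eq_0_AE enn2real_0 less_irrefl measure_def)
  then have "(\<integral>\<^sup>+x\<in>Q. \<infinity> \<partial>lebesgue) = \<infinity>"
    using Q(1) by (subst nn_integral_cmult_indicator) (simp_all add: ennreal_top_mult)
  then have "ext_average Q (\<lambda>x. - \<infinity>) = - \<infinity>"
    using Q(2) by (simp add: ext_average_def e2ennreal_neg zero_ennreal.rep_eq divide_ereal_def)
  then show ?thesis
    by (simp add: ext_exp_def)
qed

section \<open>Implications among the conditions on a fixed set\<close>

lemmas opnorm_log_plus_iff = average_le_log_plus_iff[OF Q(1,2) opnorm_B_measurable]

text \<open>Factor \<open>B x ** M\<close> as \<open>(B x ** A) ** (A' ** M)\<close>: the logarithm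
  of the second factor is constant in \<open>x\<close>, and that of the first is at most its
  \<open>log_plus\<close>. Hence \<open>C\<close> is unchanged.\<close>

lemma v_imp_viii:
  assumes "ext_exp (ext_average Q (\<lambda>x. ereal (log_plus (opnorm (B x ** A))))) \<le> ereal C" "0 < C"
  shows "ext_exp (ext_average Q (\<lambda>x. ext_log (opnorm (B x ** M)))) \<le> ereal (C * opnorm (A' ** M))"
proof (cases "M = 0")
  case True
  then have "opnorm (X ** M) = 0" for X
    by (simp add: opnorm_eq_0 matrix_matrix_mult_def vec_eq_iff)
  then show ?thesis
    using assms(2) by (simp add: ext_log_def ext_average_MInfty)
next
  case False
  let ?t = "opnorm (A' ** M)"
  have "A' ** M \<noteq> 0"
  proof
    assume "A' ** M = 0"
    then have "A ** (A' ** M) = 0"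
      by (simp add: matrix_matrix_mult_def vec_eq_iff)
    then show False
      using False by (simp add: matrix_mul_assoc inverse)
  qed
  then have t: "0 < ?t"
    using opnorm_nonneg[of "A' ** M"] opnorm_eq_0[of "A' ** M"] by linarith
  interpret log_bounded_below Q "\<lambda>x. opnorm (B x ** M)" "\<lambda>x. inv_osc x + \<bar>ln ?t\<bar>"
    by (rule log_bounded_below_opnorm[OF t])
  have avg: "average_le Q (\<lambda>x. log_plus (opnorm (B x ** A)) + ln ?t) (ln C + ln ?t)"
    by (intro average_le_add average_le_const Q opnorm_log_plus_iff[THEN iffD1, OF assms(2,1)])
  have "average_le Q (\<lambda>x. ln (opnorm (B x ** M))) (ln C + ln ?t)"
  proof (rule average_le_sandwich[OF _ Q(1) _ l(1) avg])
    show "(\<lambda>x. ln (opnorm (B x ** M))) \<in> borel_measurable lebesgue"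
      using opnorm_B_measurable by measurable
    show "AE x\<in>Q in lebesgue. - (inv_osc x + \<bar>ln ?t\<bar>) \<le> ln (opnorm (B x ** M)) \<and>
        ln (opnorm (B x ** M)) \<le> log_plus (opnorm (B x ** A)) + ln ?t"
      using pos
    proof eventually_elim
      case (elim x)
      show ?case
      proof
        assume "x \<in> Q"
        with elim have h: "0 < opnorm (B x ** M)" by simp
        have "B x ** M = (B x ** A) ** (A' ** M)"
          by (metis inverse(1) matrix_mul_assoc matrix_mul_rid)
        then have le: "opnorm (B x ** M) \<le> opnorm (B x ** A) * ?t"
          by (metis opnorm_mult)
        with h t have s: "0 < opnorm (B x ** A)"
          by (metis less_le_trans zero_less_mult_pos2)
        have "ln (opnorm (B x ** M)) \<le> ln (opnorm (B x ** A) * ?t)"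
          using h le by (intro ln_mono) auto
        also have "\<dots> = ln (opnorm (B x ** A)) + ln ?t"
          using s t by (simp add: ln_mult)
        finally show "- (inv_osc x + \<bar>ln ?t\<bar>) \<le> ln (opnorm (B x ** M)) \<and>
            ln (opnorm (B x ** M)) \<le> log_plus (opnorm (B x ** A)) + ln ?t"
          using ln_le_log_plus[of "opnorm (B x ** A)"] elim \<open>x \<in> Q\<close> by auto
      qed
    qed
  qed
  then show ?thesis
    using assms(2) t by (subst average_le_ln_iff) (simp_all add: ln_mult)
qed

lemma viii_imp_ii:
  assumes "\<And>M. ext_exp (ext_average Q (\<lambda>x. ext_log (opnorm (B x ** M)))) \<le> ereal (C * opnorm (A' ** M))"
  shows "ext_exp (ext_average Q (\<lambda>x. ext_log (norm (B x *v z)))) \<le> ereal (C * norm (A' *v z))"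
  using assms[of "column_matrix z"] by (simp add: matrix_mult_column_matrix opnorm_column_matrix)

text \<open>The choice \<open>z = A *v v\<close> makes \<open>A' *v z\<close> the unit vector
  \<open>v\<close>. The exponential factor is the cost of replacing the logarithm by
  \<open>log_plus\<close>, namely the bound on the average of \<open>inv_osc\<close>.\<close>

lemma ii_imp_iii:
  assumes ii: "\<And>z. ext_exp (ext_average Q (\<lambda>x. ext_log (norm (B x *v z)))) \<le> ereal (C * norm (A' *v z))"
    and C: "0 < C" and v: "norm v = 1"
  shows "ext_exp (ext_average Q (\<lambda>x. ereal (log_plus (norm ((B x ** A) *v v)))))
    \<le> ereal (C * exp (K / c1 powr p / p))"
proof -
  let ?M = "column_matrix (A *v v)"
  have norms: "norm ((B x ** A) *v v) = opnorm (B x ** ?M)" for x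
    by (simp add: matrix_mult_column_matrix opnorm_column_matrix matrix_vector_mul_assoc)
  have t: "opnorm (A' ** ?M) = 1"
    using v by (simp add: matrix_mult_column_matrix opnorm_column_matrix matrix_vector_mul_assoc inverse)
  interpret log_bounded_below Q "\<lambda>x. opnorm (B x ** ?M)" inv_osc
    using log_bounded_below_opnorm[of ?M] by (simp add: t)
  have "average_le Q (\<lambda>x. ln (opnorm (B x ** ?M))) (ln C)"
    using ii[of "A *v v"] v C
    by (subst average_le_ln_iff[symmetric])
      (simp_all add: matrix_mult_column_matrix opnorm_column_matrix matrix_vector_mul_assoc inverse)
  then have "average_le Q (\<lambda>x. log_plus (opnorm (B x ** ?M))) (ln C + K / c1 powr p / p)"
    using average_inv_osc by (rule average_le_log_plus)
  then show ?thesis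
    unfolding norms using C by (subst opnorm_log_plus_iff) (simp_all add: ln_mult)
qed

text \<open>Apply (iii) to the standard basis vectors. Adding one logarithmic bound per column
  produces \<open>C ^ CARD('m)\<close>, and \<open>ln (real CARD('m))\<close> in the column estimate
  produces the other factor.\<close>

lemma iii_imp_v:
  assumes iii: "\<And>v. norm v = 1 \<Longrightarrow>
      ext_exp (ext_average Q (\<lambda>x. ereal (log_plus (norm ((B x ** A) *v v))))) \<le> ereal C"
    and C: "0 < C"
  shows "ext_exp (ext_average Q (\<lambda>x. ereal (log_plus (opnorm (B x ** A)))))
    \<le> ereal (real CARD('m) * C ^ CARD('m))"
proof -
  have "average_le Q (\<lambda>x. log_plus (norm ((B x ** A) *v axis j 1))) (ln C)" for j
  proof (rule average_le_log_plus_iff[THEN iffD1, OF Q(1,2) _ C iii])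
    show "(\<lambda>x. norm ((B x ** A) *v axis j 1)) \<in> borel_measurable lebesgue"
      by (intro borel_measurable_norm_matrix_vector_mult borel_measurable_matrix_mult
          powers_measurable borel_measurable_const)
  qed simp
  then have "average_le Q (\<lambda>x. \<Sum>j\<in>UNIV. log_plus (norm ((B x ** A) *v axis j 1)))
      (\<Sum>j\<in>(UNIV :: 'm set). ln C)"
    by (intro average_le_sum)
  then have avg: "average_le Q (\<lambda>x. ln (real CARD('m)) +
      (\<Sum>j\<in>UNIV. log_plus (norm ((B x ** A) *v axis j 1))))
      (ln (real CARD('m)) + (\<Sum>j\<in>(UNIV :: 'm set). ln C))"
    by (intro average_le_add average_le_const Q)
  have "average_le Q (\<lambda>x. log_plus (opnorm (B x ** A)))
      (ln (real CARD('m)) + (\<Sum>j\<in>(UNIV :: 'm set). ln C))"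
  proof (rule average_le_sandwich[OF _ Q(1) _ _ avg])
    show "(\<lambda>x. log_plus (opnorm (B x ** A))) \<in> borel_measurable lebesgue"
      by (intro borel_measurable_log_plus opnorm_B_measurable)
    show "set_integrable lebesgue Q (\<lambda>x. 0 :: real)"
      by (simp add: set_integrable_def)
    show "AE x\<in>Q in lebesgue. - 0 \<le> log_plus (opnorm (B x ** A)) \<and> log_plus (opnorm (B x ** A))
        \<le> ln (real CARD('m)) + (\<Sum>j\<in>UNIV. log_plus (norm ((B x ** A) *v axis j 1)))"
      by (simp add: log_plus_nonneg log_plus_opnorm_le_sum_columns)
  qed
  then show ?thesis
    using C by (subst opnorm_log_plus_iff) (simp_all add: ln_mult ln_realpow)
qed

lemma v_imp_iv:
  assumes "ext_exp (ext_average Q (\<lambda>x. ereal (log_plus (opnorm (B x ** A))))) \<le> ereal C" "0 < C"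
    and U: "opnorm U = 1"
  shows "ext_exp (ext_average Q (\<lambda>x. ereal (log_plus (opnorm (B x ** A ** U))))) \<le> ereal C"
proof -
  have avg: "average_le Q (\<lambda>x. log_plus (opnorm (B x ** A))) (ln C)"
    by (rule opnorm_log_plus_iff[THEN iffD1, OF assms(2,1)])
  have "average_le Q (\<lambda>x. log_plus (opnorm (B x ** (A ** U)))) (ln C)"
  proof (rule average_le_sandwich[OF _ Q(1) _ _ avg])
    show "(\<lambda>x. log_plus (opnorm (B x ** (A ** U)))) \<in> borel_measurable lebesgue"
      by (intro borel_measurable_log_plus opnorm_B_measurable)
    show "set_integrable lebesgue Q (\<lambda>x. 0 :: real)"
      by (simp add: set_integrable_def)
    have "opnorm (B x ** (A ** U)) \<le> opnorm (B x ** A)" for x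
      using opnorm_mult[of "B x ** A" U] U by (simp add: matrix_mul_assoc)
    then show "AE x\<in>Q in lebesgue. - 0 \<le> log_plus (opnorm (B x ** (A ** U))) \<and>
        log_plus (opnorm (B x ** (A ** U))) \<le> log_plus (opnorm (B x ** A))"
      by (simp add: log_plus_nonneg log_plus_mono opnorm_nonneg)
  qed
  then show ?thesis
    by (simp only: matrix_mul_assoc[symmetric] opnorm_log_plus_iff[OF assms(2)])
qed

section \<open>The inner average in (vi) and (vii)\<close>

lemma weight_osc_eq: "weight_osc p W Q y = mat_mean (B y)"
  by (simp add: weight_osc_def mat_mean_def)

lemma weight_osc_nonneg: "0 \<le> weight_osc p W Q y"
  unfolding weight_osc_def average_def set_lebesgue_integral_def
  by (intro divide_nonneg_nonneg integral_nonneg_AE) auto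

text \<open>Needed because \<open>mat_mean\<close> with \<open>M = B y\<close> produces
  \<open>A ** B y\<close>, the reverse of the order in (v).\<close>

lemma opnorm_swap: "opnorm (A ** B y) = opnorm (B y ** A)"
  by (metis A_hermitian(1) conj_transpose_mult opnorm_conj_transpose powers_hermitian(2))

lemma weight_osc_le: "weight_osc p W Q y \<le> K / c1 powr p * opnorm (B y ** A) powr p"
  unfolding weight_osc_eq opnorm_swap[symmetric] by (rule mat_mean_le)

lemma weight_osc_ge: "opnorm (B y ** A) powr p \<le> K * c2 powr p * weight_osc p W Q y"
  unfolding weight_osc_eq opnorm_swap[symmetric] by (rule mat_mean_ge)

text \<open>The integrand is jointly measurable in \<open>(y, x)\<close> since it is built from one
  function of each variable; sigma-finiteness then gives measurability in \<open>y\<close> after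
  integrating over \<open>x\<close>.\<close>

lemma weight_osc_measurable: "weight_osc p W Q \<in> borel_measurable lebesgue"
proof -
  have "(\<lambda>z. indicator Q (snd z) *\<^sub>R opnorm (R (snd z) ** B (fst z)) powr p)
      \<in> borel_measurable (lebesgue \<Otimes>\<^sub>M lebesgue)"
  proof (intro borel_measurable_scaleR powr_real_measurable borel_measurable_opnorm
      borel_measurable_matrix_mult borel_measurable_const)
    show "(\<lambda>z. indicator Q (snd z) :: real) \<in> borel_measurable (lebesgue \<Otimes>\<^sub>M lebesgue)"
      by (rule measurable_compose[OF measurable_snd borel_measurable_indicator[OF Q(1)]])
    show "(\<lambda>z. R (snd z)) \<in> borel_measurable (lebesgue \<Otimes>\<^sub>M lebesgue)"
      by (rule measurable_compose[OF measurable_snd powers_measurable(1)])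
    show "(\<lambda>z. B (fst z)) \<in> borel_measurable (lebesgue \<Otimes>\<^sub>M lebesgue)"
      by (rule measurable_compose[OF measurable_fst powers_measurable(2)])
  qed
  then have "(\<lambda>y. LINT x|lebesgue. indicator Q x *\<^sub>R opnorm (R x ** B y) powr p)
      \<in> borel_measurable lebesgue"
    by (intro sigma_finite_measure.borel_measurable_lebesgue_integral[OF sigma_finite_lebesgue])
      (simp add: case_prod_beta')
  then show ?thesis
    unfolding weight_osc_def[abs_def] average_def set_lebesgue_integral_def
    by (intro borel_measurable_divide) auto
qed

lemmas osc_log_plus_iff = average_le_log_plus_iff[OF Q(1,2) weight_osc_measurable]

text \<open>The comparison factor may be smaller than 1, hence its \<open>log_plus\<close> in the
  constant; the exponent \<open>p\<close> is pulled out by \<open>log_plus_powr\<close>.\<close>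

lemma v_imp_vi:
  assumes "ext_exp (ext_average Q (\<lambda>x. ereal (log_plus (opnorm (B x ** A))))) \<le> ereal C" "0 < C"
  shows "ext_exp (ext_average Q (\<lambda>y. ereal (log_plus (weight_osc p W Q y))))
    \<le> ereal (exp (log_plus (K / c1 powr p)) * C powr p)"
proof -
  have "average_le Q (\<lambda>x. log_plus (opnorm (B x ** A))) (ln C)"
    by (rule opnorm_log_plus_iff[THEN iffD1, OF assms(2,1)])
  then have avg: "average_le Q (\<lambda>x. log_plus (K / c1 powr p) + p * log_plus (opnorm (B x ** A)))
      (log_plus (K / c1 powr p) + p * ln C)"
    using p by (intro average_le_add average_le_const Q average_le_cmult) auto
  have "average_le Q (\<lambda>x. log_plus (weight_osc p W Q x)) (log_plus (K / c1 powr p) + p * ln C)"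
  proof (rule average_le_sandwich[OF _ Q(1) _ _ avg])
    show "(\<lambda>x. log_plus (weight_osc p W Q x)) \<in> borel_measurable lebesgue"
      by (intro borel_measurable_log_plus weight_osc_measurable)
    show "set_integrable lebesgue Q (\<lambda>x. 0 :: real)"
      by (simp add: set_integrable_def)
    have "log_plus (weight_osc p W Q x)
        \<le> log_plus (K / c1 powr p) + p * log_plus (opnorm (B x ** A))" for x
    proof -
      have "log_plus (weight_osc p W Q x) \<le> log_plus (K / c1 powr p * opnorm (B x ** A) powr p)"
        by (intro log_plus_mono weight_osc_nonneg weight_osc_le)
      also have "\<dots> \<le> log_plus (K / c1 powr p) + log_plus (opnorm (B x ** A) powr p)"
        using K_pos by (intro log_plus_mult) auto
      finally show ?thesis
        by (simp add: log_plus_powr opnorm_nonneg p)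
    qed
    then show "AE x\<in>Q in lebesgue. - 0 \<le> log_plus (weight_osc p W Q x) \<and>
        log_plus (weight_osc p W Q x) \<le> log_plus (K / c1 powr p) + p * log_plus (opnorm (B x ** A))"
      by (simp add: log_plus_nonneg)
  qed
  then show ?thesis
    using assms(2) by (subst osc_log_plus_iff) (simp_all add: ln_mult ln_powr)
qed

lemma vi_imp_v:
  assumes "ext_exp (ext_average Q (\<lambda>y. ereal (log_plus (weight_osc p W Q y)))) \<le> ereal C" "0 < C"
  shows "ext_exp (ext_average Q (\<lambda>x. ereal (log_plus (opnorm (B x ** A)))))
    \<le> ereal ((exp (log_plus (K * c2 powr p)) * C) powr (1/p))"
proof -
  have "average_le Q (\<lambda>x. log_plus (weight_osc p W Q x)) (ln C)"
    by (rule osc_log_plus_iff[THEN iffD1, OF assms(2,1)])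
  then have avg: "average_le Q (\<lambda>x. 1/p * (log_plus (K * c2 powr p) + log_plus (weight_osc p W Q x)))
      (1/p * (log_plus (K * c2 powr p) + ln C))"
    using p by (intro average_le_add average_le_const Q average_le_cmult) auto
  have "average_le Q (\<lambda>x. log_plus (opnorm (B x ** A))) (1/p * (log_plus (K * c2 powr p) + ln C))"
  proof (rule average_le_sandwich[OF _ Q(1) _ _ avg])
    show "(\<lambda>x. log_plus (opnorm (B x ** A))) \<in> borel_measurable lebesgue"
      by (intro borel_measurable_log_plus opnorm_B_measurable)
    show "set_integrable lebesgue Q (\<lambda>x. 0 :: real)"
      by (simp add: set_integrable_def)
    have "log_plus (opnorm (B x ** A))
        \<le> 1/p * (log_plus (K * c2 powr p) + log_plus (weight_osc p W Q x))" for x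
    proof -
      have "p * log_plus (opnorm (B x ** A)) = log_plus (opnorm (B x ** A) powr p)"
        by (simp add: log_plus_powr opnorm_nonneg p)
      also have "\<dots> \<le> log_plus (K * c2 powr p * weight_osc p W Q x)"
        by (intro log_plus_mono weight_osc_ge) simp
      also have "\<dots> \<le> log_plus (K * c2 powr p) + log_plus (weight_osc p W Q x)"
        using K_pos weight_osc_nonneg by (intro log_plus_mult) auto
      finally show ?thesis
        using p by (simp add: field_simps)
    qed
    then show "AE x\<in>Q in lebesgue. - 0 \<le> log_plus (opnorm (B x ** A)) \<and> log_plus (opnorm (B x ** A))
        \<le> 1/p * (log_plus (K * c2 powr p) + log_plus (weight_osc p W Q x))"
      by (simp add: log_plus_nonneg)
  qed
  then show ?thesis
    using assms(2) by (subst opnorm_log_plus_iff) (simp_all add: ln_mult ln_powr)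
qed

lemma average_inv_osc_affine:
  "average_le Q (\<lambda>x. log_plus (K * c2 powr p) + p * inv_osc x)
    (log_plus (K * c2 powr p) + K / c1 powr p)"
proof -
  have "average_le Q (\<lambda>x. p * inv_osc x) (p * (K / c1 powr p / p))"
    using p by (intro average_le_cmult average_inv_osc) simp
  then have "average_le Q (\<lambda>x. p * inv_osc x) (K / c1 powr p)"
    using p by simp
  then show ?thesis
    by (intro average_le_add average_le_const Q)
qed

text \<open>For \<open>M = A\<close> the norm of \<open>A' ** M\<close> is 1, so
  \<open>- ln (opnorm (B x ** A))\<close> is at most \<open>inv_osc x\<close>;
  \<open>weight_osc_ge\<close> carries this over to the inner average.\<close>

lemma log_bounded_below_weight_osc:
  "log_bounded_below Q (weight_osc p W Q) (\<lambda>x. log_plus (K * c2 powr p) + p * inv_osc x)"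
proof
  show "Q \<in> sets lebesgue" "0 < measure lebesgue Q"
    by (fact Q)+
  show "weight_osc p W Q \<in> borel_measurable lebesgue"
    by (rule weight_osc_measurable)
  show "set_integrable lebesgue Q (\<lambda>x. log_plus (K * c2 powr p) + p * inv_osc x)"
    using average_inv_osc_affine by (simp add: average_le_def)
  show "0 \<le> log_plus (K * c2 powr p) + p * inv_osc x" for x
    using p inv_osc_nonneg log_plus_nonneg by (intro add_nonneg_nonneg mult_nonneg_nonneg) auto
  show "AE x\<in>Q in lebesgue. 0 < weight_osc p W Q x \<and>
      - ln (weight_osc p W Q x) \<le> log_plus (K * c2 powr p) + p * inv_osc x"
    using AE_powers_inverse
  proof eventually_elim
    case (elim x)
    let ?s = "opnorm (B x ** A)" and ?k = "K * c2 powr p"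
    have s: "0 < ?s" "- ln ?s \<le> inv_osc x"
      using ln_opnorm_lower[OF elim, of A] by (simp_all add: inverse opnorm_mat_1)
    have k: "0 < ?k"
      using K_pos c2 by simp
    have "0 < ?s powr p"
      using s by simp
    then have "0 < ?k * weight_osc p W Q x"
      using weight_osc_ge[of x] by linarith
    then have o: "0 < weight_osc p W Q x"
      using k by (simp add: zero_less_mult_iff)
    have "p * ln ?s = ln (?s powr p)"
      using s by (simp add: ln_powr)
    also have "\<dots> \<le> ln (?k * weight_osc p W Q x)"
      using s weight_osc_ge[of x] by (intro ln_mono) auto
    also have "\<dots> = ln ?k + ln (weight_osc p W Q x)"
      using k o by (simp add: ln_mult_pos)
    finally have "- ln (weight_osc p W Q x) \<le> ln ?k + p * - ln ?s"
      by simp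
    also have "\<dots> \<le> log_plus ?k + p * inv_osc x"
      using s p by (intro add_mono ln_le_log_plus mult_left_mono) auto
    finally show ?case
      using o by simp
  qed
qed

text \<open>Since \<open>ln\<close> lies below \<open>log_plus\<close>, the constant
  \<open>C\<close> survives; the minorant makes the logarithm integrable, so that its extended
  average is the ordinary one.\<close>

lemma vi_imp_vii:
  assumes "ext_exp (ext_average Q (\<lambda>y. ereal (log_plus (weight_osc p W Q y)))) \<le> ereal C" "0 < C"
  shows "set_integrable lebesgue Q (\<lambda>y. log_plus (weight_osc p W Q y))"
    and "ext_exp (ext_average Q (\<lambda>y. ext_log (weight_osc p W Q y))) \<le> ereal C"
proof -
  interpret log_bounded_below Q "weight_osc p W Q" "\<lambda>x. log_plus (K * c2 powr p) + p * inv_osc x"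
    by (rule log_bounded_below_weight_osc)
  have avg: "average_le Q (\<lambda>x. log_plus (weight_osc p W Q x)) (ln C)"
    by (rule osc_log_plus_iff[THEN iffD1, OF assms(2,1)])
  then show "set_integrable lebesgue Q (\<lambda>y. log_plus (weight_osc p W Q y))"
    by (simp add: average_le_def)
  show "ext_exp (ext_average Q (\<lambda>y. ext_log (weight_osc p W Q y))) \<le> ereal C"
    unfolding average_le_ln_iff[OF assms(2)] by (rule average_le_ln[OF avg])
qed

lemma vii_imp_vi:
  assumes "ext_exp (ext_average Q (\<lambda>y. ext_log (weight_osc p W Q y))) \<le> ereal C" "0 < C"
  shows "ext_exp (ext_average Q (\<lambda>y. ereal (log_plus (weight_osc p W Q y))))
    \<le> ereal (C * exp (log_plus (K * c2 powr p) + K / c1 powr p))"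
proof -
  interpret log_bounded_below Q "weight_osc p W Q" "\<lambda>x. log_plus (K * c2 powr p) + p * inv_osc x"
    by (rule log_bounded_below_weight_osc)
  have "average_le Q (\<lambda>x. log_plus (weight_osc p W Q x))
      (ln C + (log_plus (K * c2 powr p) + K / c1 powr p))"
    using assms by (intro average_le_log_plus average_inv_osc_affine) (simp add: average_le_ln_iff)
  then show ?thesis
    using assms(2) by (subst osc_log_plus_iff) (simp_all add: ln_mult)
qed

section \<open>The supremum in Volberg's condition\<close>

lemma weight_mean_bounds:
  "c1 * weight_mean p W Q z \<le> norm (A *v z)" "norm (A *v z) \<le> c2 * weight_mean p W Q z"
  using reducing by (simp_all add: reducing_operator_def)

lemma A_norm_pos: "u \<noteq> 0 \<Longrightarrow> 0 < norm (A *v u)"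
  by (metis inverse(2) matrix_vector_mul_assoc matrix_vector_mul_lid matrix_vector_mult_0_right
      zero_less_norm_iff)

lemma weight_mean_pos: "u \<noteq> 0 \<Longrightarrow> 0 < weight_mean p W Q u"
  using less_le_trans[OF A_norm_pos weight_mean_bounds(2)] c2 by (simp add: zero_less_mult_iff)

text \<open>Hermitian symmetry of \<open>A'\<close> moves it across the inner product. The supremum
  over \<open>u\<close> is then comparable to the dual norm of \<open>norm (A *v u)\<close> at
  \<open>z\<close>, which is \<open>norm (A' *v z)\<close>.\<close>

lemma cinner_vec_factor: "cinner_vec z u = cinner_vec (A' *v z) (A *v u)"
  by (simp add: cinner_vec_conj_transpose A_hermitian matrix_vector_mul_assoc inverse)

lemma tilde_SUP_le:
  "(SUP u\<in>UNIV - {0}. ereal (cmod (cinner_vec z u) * vec_mean u powr (-1/p)))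
    \<le> ereal (c2 * norm (A' *v z))"
proof (rule SUP_least)
  fix u :: "complex^'m" assume "u \<in> UNIV - {0}"
  then have u: "0 < weight_mean p W Q u"
    using weight_mean_pos by blast
  have eq: "vec_mean u powr (-1/p) = 1 / weight_mean p W Q u"
    unfolding weight_mean_eq minus_divide_left[symmetric] by (rule powr_minus_divide)
  have "cmod (cinner_vec z u) \<le> norm (A' *v z) * norm (A *v u)"
    by (subst cinner_vec_factor) (rule cmod_cinner_vec_le)
  also have "\<dots> \<le> norm (A' *v z) * (c2 * weight_mean p W Q u)"
    by (intro mult_left_mono weight_mean_bounds norm_ge_zero)
  finally have "cmod (cinner_vec z u) * (1 / weight_mean p W Q u) \<le> c2 * norm (A' *v z)"
    using u by (simp add: pos_divide_le_eq mult_ac)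
  then show "ereal (cmod (cinner_vec z u) * vec_mean u powr (-1/p)) \<le> ereal (c2 * norm (A' *v z))"
    unfolding eq ereal_less_eq .
qed

lemma tilde_SUP_ge:
  "ereal (c1 * norm (A' *v z))
    \<le> (SUP u\<in>UNIV - {0}. ereal (cmod (cinner_vec z u) * vec_mean u powr (-1/p)))"
proof (cases "z = 0")
  case True
  \<comment> \<open>For \<open>z = 0\<close> the extremal vector used below would be 0, which the
    supremum excludes; any nonzero vector shows that the supremum is at least 0.\<close>
  have "axis undefined 1 \<in> UNIV - {0 :: complex^'m}"
    by (simp add: axis_eq_0_iff)
  then show ?thesis
    by (rule SUP_upper2) (simp add: True)
next
  case False
  \<comment> \<open>The equality case of Cauchy-Schwarz: \<open>A *v u\<close> coincides with
    \<open>A' *v z\<close>.\<close>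
  define u where "u = A' *v (A' *v z)"
  have Au: "A *v u = A' *v z"
    by (simp add: u_def matrix_vector_mul_assoc matrix_mul_assoc inverse)
  have Az: "A' *v z \<noteq> 0"
    using False by (metis inverse(1) matrix_vector_mul_assoc matrix_vector_mul_lid matrix_vector_mult_0_right)
  have "u \<noteq> 0"
    using Az Au by auto
  then have u: "0 < weight_mean p W Q u"
    by (rule weight_mean_pos)
  have eq: "vec_mean u powr (-1/p) = 1 / weight_mean p W Q u"
    unfolding weight_mean_eq minus_divide_left[symmetric] by (rule powr_minus_divide)
  have "c1 * weight_mean p W Q u \<le> norm (A' *v z)"
    using weight_mean_bounds(1)[of u] by (simp add: Au)
  then have "c1 * weight_mean p W Q u * norm (A' *v z) \<le> norm (A' *v z) * norm (A' *v z)"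
    by (rule mult_right_mono) simp
  moreover have "cmod (cinner_vec z u) = norm (A' *v z) * norm (A' *v z)"
    using cinner_vec_factor[of z u] by (simp add: Au cinner_vec_self norm_mult power2_eq_square)
  ultimately have "c1 * norm (A' *v z) \<le> cmod (cinner_vec z u) * (1 / weight_mean p W Q u)"
    using u by (simp add: pos_le_divide_eq mult_ac)
  then have "c1 * norm (A' *v z) \<le> cmod (cinner_vec z u) * vec_mean u powr (-1/p)"
    unfolding eq .
  then show ?thesis
    using \<open>u \<noteq> 0\<close> by (intro SUP_upper2[of u]) auto
qed

end

text \<open>The core is the cycle (v), (viii), (ii), (iii), (v). Conditions (iv) and (vi) are each
  equivalent to (v), (vii) is equivalent to (vi), and (i) to (ii). Each arrow turns a constant valid
  for every cube into another constant chosen before the cube is fixed.\<close>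

theorem proposition3p7:
  fixes p c1 c2 :: real
    and W :: "real^'n \<Rightarrow> complex^'m^'m"
    and A :: "(real^'n) set \<Rightarrow> complex^'m^'m"
  assumes "0 < p" and "matrix_weight W"
    and "0 < c1" and "0 < c2"
    and "\<And>Q. is_cube Q \<Longrightarrow> reducing_operator c1 c2 p W Q (A Q)"
  defines "cond_i \<equiv> Ap_infty_tilde p W"
    and "cond_ii \<equiv> (\<exists>C>0. \<forall>Q. is_cube Q \<longrightarrow> (\<forall>z.
          ext_exp (ext_average Q (\<lambda>x. ext_log (norm (mat_powr (W x) (-1/p) *v z))))
          \<le> ereal (C * norm (matrix_inv (A Q) *v z))))"
    and "cond_iii \<equiv> (\<exists>C>0. \<forall>Q. is_cube Q \<longrightarrow> (\<forall>v. norm v = 1 \<longrightarrow>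
          ext_exp (ext_average Q
            (\<lambda>x. ereal (log_plus (norm ((mat_powr (W x) (-1/p) ** A Q) *v v))))) \<le> ereal C))"
    and "cond_iv \<equiv> (\<exists>C>0. \<forall>Q. is_cube Q \<longrightarrow> (\<forall>U. opnorm U = 1 \<longrightarrow>
          ext_exp (ext_average Q
            (\<lambda>x. ereal (log_plus (opnorm (mat_powr (W x) (-1/p) ** A Q ** U))))) \<le> ereal C))"
    and "cond_v \<equiv> (\<exists>C>0. \<forall>Q. is_cube Q \<longrightarrow>
          ext_exp (ext_average Q
            (\<lambda>x. ereal (log_plus (opnorm (mat_powr (W x) (-1/p) ** A Q))))) \<le> ereal C)"
    and "cond_vi \<equiv> (\<exists>C>0. \<forall>Q. is_cube Q \<longrightarrow>
          ext_exp (ext_average Q (\<lambda>y. ereal (log_plus (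
            average Q (\<lambda>x. opnorm (mat_powr (W x) (1/p) ** mat_powr (W y) (-1/p)) powr p)))))
          \<le> ereal C)"
    and "cond_vii \<equiv> Ap_infty p W"
    and "cond_viii \<equiv> (\<exists>C>0. \<forall>Q. is_cube Q \<longrightarrow> (\<forall>M.
          ext_exp (ext_average Q (\<lambda>x. ext_log (opnorm (mat_powr (W x) (-1/p) ** M))))
          \<le> ereal (C * opnorm (matrix_inv (A Q) ** M))))"
  shows "(cond_i \<longleftrightarrow> cond_ii) \<and> (cond_i \<longleftrightarrow> cond_iii) \<and> (cond_i \<longleftrightarrow> cond_iv) \<and> (cond_i \<longleftrightarrow> cond_v) \<and>
         (cond_i \<longleftrightarrow> cond_vi) \<and> (cond_i \<longleftrightarrow> cond_vii) \<and> (cond_i \<longleftrightarrow> cond_viii)"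
proof -
  define K where "K = real CARD('m) powr p * real CARD('m)"
  have K: "0 < K"
    by (simp add: K_def)
  have red: "reduced_weight p c1 c2 K W Q (A Q)" if "is_cube Q" for Q
    by (rule reduced_weight.intro[OF assms(1-4) assms(5)[OF that] K_def])
  note vec_mean = reduced_weight.vec_mean_def[OF red]
  have vi_eq: "cond_vi \<longleftrightarrow> (\<exists>C>0. \<forall>Q. is_cube Q \<longrightarrow>
      ext_exp (ext_average Q (\<lambda>y. ereal (log_plus (weight_osc p W Q y)))) \<le> ereal C)"
    unfolding cond_vi_def weight_osc_def by (rule refl)
  have "cond_viii" if c: cond_v
  proof -
    obtain C where "0 < C" and C: "\<And>Q. is_cube Q \<Longrightarrow> ext_exp (ext_average Q
        (\<lambda>x. ereal (log_plus (opnorm (mat_powr (W x) (-1/p) ** A Q))))) \<le> ereal C"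
      using c unfolding cond_v_def by blast
    show ?thesis
      unfolding cond_viii_def
    proof (intro exI[of _ C] conjI allI impI \<open>0 < C\<close>)
      fix Q :: "(real^'n) set" and M :: "complex^'m^'m" assume Q: "is_cube Q"
      show "ext_exp (ext_average Q (\<lambda>x. ext_log (opnorm (mat_powr (W x) (-1/p) ** M))))
          \<le> ereal (C * opnorm (matrix_inv (A Q) ** M))"
        by (rule reduced_weight.v_imp_viii[OF red[OF Q] C[OF Q] \<open>0 < C\<close>])
    qed
  qed
  moreover have "cond_ii" if c: cond_viii
  proof -
    obtain C where "0 < C" and C: "\<And>Q M. is_cube Q \<Longrightarrow>
        ext_exp (ext_average Q (\<lambda>x. ext_log (opnorm (mat_powr (W x) (-1/p) ** M))))
        \<le> ereal (C * opnorm (matrix_inv (A Q) ** M))"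
      using c unfolding cond_viii_def by blast
    show ?thesis
      unfolding cond_ii_def
    proof (intro exI[of _ C] conjI allI impI \<open>0 < C\<close>)
      fix Q :: "(real^'n) set" and z :: "complex^'m" assume Q: "is_cube Q"
      show "ext_exp (ext_average Q (\<lambda>x. ext_log (norm (mat_powr (W x) (-1/p) *v z))))
          \<le> ereal (C * norm (matrix_inv (A Q) *v z))"
        by (rule reduced_weight.viii_imp_ii[OF red[OF Q] C[OF Q]])
    qed
  qed
  moreover have "cond_iii" if c: cond_ii
  proof -
    obtain C where "0 < C" and C: "\<And>Q z. is_cube Q \<Longrightarrow>
        ext_exp (ext_average Q (\<lambda>x. ext_log (norm (mat_powr (W x) (-1/p) *v z))))
        \<le> ereal (C * norm (matrix_inv (A Q) *v z))"
      using c unfolding cond_ii_def by blast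
    show ?thesis
      unfolding cond_iii_def
    proof (intro exI[of _ "C * exp (K / c1 powr p / p)"] conjI allI impI)
      fix Q :: "(real^'n) set" and v :: "complex^'m" assume Q: "is_cube Q" and v: "norm v = 1"
      show "ext_exp (ext_average Q
          (\<lambda>x. ereal (log_plus (norm ((mat_powr (W x) (-1/p) ** A Q) *v v)))))
          \<le> ereal (C * exp (K / c1 powr p / p))"
        by (rule reduced_weight.ii_imp_iii[OF red[OF Q] C[OF Q] \<open>0 < C\<close> v])
    qed (simp add: \<open>0 < C\<close>)
  qed
  moreover have "cond_v" if c: cond_iii
  proof -
    obtain C where "0 < C" and C: "\<And>Q v. is_cube Q \<Longrightarrow> norm v = 1 \<Longrightarrow>
        ext_exp (ext_average Q
          (\<lambda>x. ereal (log_plus (norm ((mat_powr (W x) (-1/p) ** A Q) *v v))))) \<le> ereal C"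
      using c unfolding cond_iii_def by blast
    show ?thesis
      unfolding cond_v_def
    proof (intro exI[of _ "real CARD('m) * C ^ CARD('m)"] conjI allI impI)
      fix Q :: "(real^'n) set" assume Q: "is_cube Q"
      show "ext_exp (ext_average Q (\<lambda>x. ereal (log_plus (opnorm (mat_powr (W x) (-1/p) ** A Q)))))
          \<le> ereal (real CARD('m) * C ^ CARD('m))"
        by (rule reduced_weight.iii_imp_v[OF red[OF Q] C[OF Q] \<open>0 < C\<close>])
    qed (simp add: \<open>0 < C\<close>)
  qed
  moreover have "cond_iv" if c: cond_v
  proof -
    obtain C where "0 < C" and C: "\<And>Q. is_cube Q \<Longrightarrow> ext_exp (ext_average Q
        (\<lambda>x. ereal (log_plus (opnorm (mat_powr (W x) (-1/p) ** A Q))))) \<le> ereal C"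
      using c unfolding cond_v_def by blast
    show ?thesis
      unfolding cond_iv_def
    proof (intro exI[of _ C] conjI allI impI \<open>0 < C\<close>)
      fix Q :: "(real^'n) set" and U :: "complex^'m^'m" assume Q: "is_cube Q" and U: "opnorm U = 1"
      show "ext_exp (ext_average Q
          (\<lambda>x. ereal (log_plus (opnorm (mat_powr (W x) (-1/p) ** A Q ** U))))) \<le> ereal C"
        by (rule reduced_weight.v_imp_iv[OF red[OF Q] C[OF Q] \<open>0 < C\<close> U])
    qed
  qed
  moreover have "cond_v" if c: cond_iv
  proof -
    obtain C where "0 < C" and C: "\<And>Q U. is_cube Q \<Longrightarrow> opnorm U = 1 \<Longrightarrow>
        ext_exp (ext_average Q
          (\<lambda>x. ereal (log_plus (opnorm (mat_powr (W x) (-1/p) ** A Q ** U))))) \<le> ereal C"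
      using c unfolding cond_iv_def by blast
    show ?thesis
      unfolding cond_v_def
    proof (intro exI[of _ C] conjI allI impI \<open>0 < C\<close>)
      fix Q :: "(real^'n) set" assume Q: "is_cube Q"
      \<comment> \<open>The identity matrix is an admissible \<open>U\<close>.\<close>
      show "ext_exp (ext_average Q
          (\<lambda>x. ereal (log_plus (opnorm (mat_powr (W x) (-1/p) ** A Q))))) \<le> ereal C"
        using C[OF Q opnorm_mat_1] unfolding matrix_mul_rid .
    qed
  qed
  moreover have "cond_vi" if c: cond_v
  proof -
    obtain C where "0 < C" and C: "\<And>Q. is_cube Q \<Longrightarrow> ext_exp (ext_average Q
        (\<lambda>x. ereal (log_plus (opnorm (mat_powr (W x) (-1/p) ** A Q))))) \<le> ereal C"
      using c unfolding cond_v_def by blast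
    show ?thesis
      unfolding vi_eq
    proof (intro exI[of _ "exp (log_plus (K / c1 powr p)) * C powr p"] conjI allI impI)
      fix Q :: "(real^'n) set" assume Q: "is_cube Q"
      show "ext_exp (ext_average Q (\<lambda>y. ereal (log_plus (weight_osc p W Q y))))
          \<le> ereal (exp (log_plus (K / c1 powr p)) * C powr p)"
        by (rule reduced_weight.v_imp_vi[OF red[OF Q] C[OF Q] \<open>0 < C\<close>])
    qed (use \<open>0 < C\<close> in simp)
  qed
  moreover have "cond_v" if c: cond_vi
  proof -
    obtain C where "0 < C" and C: "\<And>Q. is_cube Q \<Longrightarrow>
        ext_exp (ext_average Q (\<lambda>y. ereal (log_plus (weight_osc p W Q y)))) \<le> ereal C"
      using c unfolding vi_eq by blast
    show ?thesis
      unfolding cond_v_def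
    proof (intro exI[of _ "(exp (log_plus (K * c2 powr p)) * C) powr (1/p)"] conjI allI impI)
      fix Q :: "(real^'n) set" assume Q: "is_cube Q"
      show "ext_exp (ext_average Q (\<lambda>x. ereal (log_plus (opnorm (mat_powr (W x) (-1/p) ** A Q)))))
          \<le> ereal ((exp (log_plus (K * c2 powr p)) * C) powr (1/p))"
        by (rule reduced_weight.vi_imp_v[OF red[OF Q] C[OF Q] \<open>0 < C\<close>])
    qed (use \<open>0 < C\<close> in simp)
  qed
  moreover have "cond_vii" if c: cond_vi
  proof -
    obtain C where "0 < C" and C: "\<And>Q. is_cube Q \<Longrightarrow>
        ext_exp (ext_average Q (\<lambda>y. ereal (log_plus (weight_osc p W Q y)))) \<le> ereal C"
      using c unfolding vi_eq by blast
    have vii: "set_integrable lebesgue Q (\<lambda>y. log_plus (weight_osc p W Q y))"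
      "ext_exp (ext_average Q (\<lambda>y. ext_log (weight_osc p W Q y))) \<le> ereal C" if "is_cube Q" for Q
      using reduced_weight.vi_imp_vii[OF red[OF that] C[OF that] \<open>0 < C\<close>] .
    have "Ap_infty_const p W \<le> ereal C"
      unfolding Ap_infty_const_def by (rule SUP_least) (simp add: vii(2))
    then have "Ap_infty_const p W < \<infinity>"
      by auto
    with vii(1) assms(2) show ?thesis
      unfolding cond_vii_def Ap_infty_def by blast
  qed
  moreover have "cond_vi" if c: cond_vii
  proof -
    have "Ap_infty_const p W < \<infinity>"
      using c by (simp add: cond_vii_def Ap_infty_def)
    then obtain k :: nat where k: "Ap_infty_const p W < ereal (real k)"
      by (auto simp: less_PInf_Ex_of_nat)
    \<comment> \<open>A finite supremum lies below some natural number; the added 1 makes positivity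
      of the constant evident.\<close>
    define C where "C = real k + 1"
    have C: "ext_exp (ext_average Q (\<lambda>y. ext_log (weight_osc p W Q y))) \<le> ereal C" if "is_cube Q" for Q
    proof -
      have "ext_exp (ext_average Q (\<lambda>y. ext_log (weight_osc p W Q y))) \<le> Ap_infty_const p W"
        unfolding Ap_infty_const_def using that by (intro SUP_upper) simp
      also have "\<dots> \<le> ereal C"
        by (rule order_trans[OF less_imp_le[OF k]]) (simp add: C_def)
      finally show ?thesis .
    qed
    have "0 < C"
      by (simp add: C_def)
    show ?thesis
      unfolding vi_eq
    proof (intro exI[of _ "C * exp (log_plus (K * c2 powr p) + K / c1 powr p)"] conjI allI impI)
      fix Q :: "(real^'n) set" assume Q: "is_cube Q"
      show "ext_exp (ext_average Q (\<lambda>y. ereal (log_plus (weight_osc p W Q y))))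
          \<le> ereal (C * exp (log_plus (K * c2 powr p) + K / c1 powr p))"
        by (rule reduced_weight.vii_imp_vi[OF red[OF Q] C[OF Q] \<open>0 < C\<close>])
    qed (simp add: \<open>0 < C\<close>)
  qed
  moreover have "cond_ii" if c: cond_i
  proof -
    obtain C where "0 < C" and C: "\<And>Q z. is_cube Q \<Longrightarrow>
        ext_exp (ext_average Q (\<lambda>x. ext_log (norm (mat_powr (W x) (-1/p) *v z))))
        \<le> ereal C * (SUP u\<in>UNIV - {0}. ereal (cmod (cinner_vec z u) *
            average Q (\<lambda>x. norm (mat_powr (W x) (1/p) *v u) powr p) powr (-1/p)))"
      using c unfolding cond_i_def Ap_infty_tilde_def by blast
    show ?thesis
      unfolding cond_ii_def
    proof (intro exI[of _ "C * c2"] conjI allI impI)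
      fix Q :: "(real^'n) set" and z :: "complex^'m" assume Q: "is_cube Q"
      have "ereal C * (SUP u\<in>UNIV - {0}. ereal (cmod (cinner_vec z u) *
            average Q (\<lambda>x. norm (mat_powr (W x) (1/p) *v u) powr p) powr (-1/p)))
          \<le> ereal C * ereal (c2 * norm (matrix_inv (A Q) *v z))"
        using reduced_weight.tilde_SUP_le[OF red[OF Q], of z] \<open>0 < C\<close> unfolding vec_mean[OF Q]
        by (intro ereal_mult_left_mono) simp_all
      also have "\<dots> = ereal (C * c2 * norm (matrix_inv (A Q) *v z))"
        by (simp add: mult.assoc)
      finally show "ext_exp (ext_average Q (\<lambda>x. ext_log (norm (mat_powr (W x) (-1/p) *v z))))
          \<le> ereal (C * c2 * norm (matrix_inv (A Q) *v z))"
        by (rule order_trans[OF C[OF Q]])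
    qed (simp add: \<open>0 < C\<close> assms(4))
  qed
  moreover have "cond_i" if c: cond_ii
  proof -
    obtain C where "0 < C" and C: "\<And>Q z. is_cube Q \<Longrightarrow>
        ext_exp (ext_average Q (\<lambda>x. ext_log (norm (mat_powr (W x) (-1/p) *v z))))
        \<le> ereal (C * norm (matrix_inv (A Q) *v z))"
      using c unfolding cond_ii_def by blast
    have "ext_exp (ext_average Q (\<lambda>x. ext_log (norm (mat_powr (W x) (-1/p) *v z))))
        \<le> ereal (C / c1) * (SUP u\<in>UNIV - {0}. ereal (cmod (cinner_vec z u) *
            average Q (\<lambda>x. norm (mat_powr (W x) (1/p) *v u) powr p) powr (-1/p)))"
      if Q: "is_cube Q" for Q z
    proof -
      \<comment> \<open>Dividing by \<open>c1\<close> compensates for the lower equivalence constant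
        in \<open>tilde_SUP_ge\<close>.\<close>
      have "ereal (C * norm (matrix_inv (A Q) *v z))
          = ereal (C / c1) * ereal (c1 * norm (matrix_inv (A Q) *v z))"
        using assms(3) by simp
      also have "\<dots> \<le> ereal (C / c1) * (SUP u\<in>UNIV - {0}. ereal (cmod (cinner_vec z u) *
            average Q (\<lambda>x. norm (mat_powr (W x) (1/p) *v u) powr p) powr (-1/p)))"
        using reduced_weight.tilde_SUP_ge[OF red[OF Q], of z] \<open>0 < C\<close> assms(3)
        unfolding vec_mean[OF Q] by (intro ereal_mult_left_mono) simp_all
      finally show ?thesis
        by (rule order_trans[OF C[OF Q]])
    qed
    then show ?thesis
      unfolding cond_i_def Ap_infty_tilde_def using \<open>0 < C\<close> assms(2,3)
      by (intro conjI exI[of _ "C / c1"] allI impI) simp_all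
  qed
  ultimately show ?thesis by argo
qed

end
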